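(* Let $p,q\ge 1$, $\boldsymbol{\mu}\in\mathbb{R}^p$, let $\Sigma$ be a $p\times p$ symmetric positive definite matrix, let $\Lambda$ be a real $p\times q$ matrix, and let $\omega>0,\beta>0,\gamma\ge 0$. Let $\boldsymbol{Z}_0\sim\mathcal{N}_q(\boldsymbol{0},\boldsymbol{I}_q)$, $\boldsymbol{Z}_1\sim\mathcal{N}_p(\boldsymbol{0},\boldsymbol{I}_p)$ and $G$ be mutually independent, where $G$ has the generalized Lindley density $$f(g\mid\omega,\beta,\gamma)=\frac{\beta^{\omega+1}g^{\omega-1}(\omega+\gamma g)}{(\beta+\gamma)\Gamma(\omega+1)}e^{-\beta g},\qquad g>0,$$ and define $$\boldsymbol{Y}=\boldsymbol{\mu}+\frac{\Lambda|\boldsymbol{Z}_0|+\Sigma^{1/2}\boldsymbol{Z}_1}{\sqrt{G}},$$ where $|\boldsymbol{Z}_0|$ is taken componentwise. Then $\boldsymbol{Y}$ has density $$f(\boldsymbol{y})=\frac{2^{q}\beta^{1-\frac p2}\omega^{\frac p2}}{\beta+\gamma}\,t_p\!\Big(\sqrt{\tfrac{\omega}{\beta}}(\boldsymbol{y}-\boldsymbol{\mu})\,\Big|\,\boldsymbol{0},\Omega,2\omega\Big)\,T_q\!\Big(\boldsymbol{m}\sqrt{\tfrac{p+2\omega}{2\beta+d(\boldsymbol{y})}}\,\Big|\,\boldsymbol{0},\Delta,p+2\omega\Big)$$ $$+\frac{2^{q}\gamma\beta^{-\frac p2}(\omega+1)^{\frac p2}}{\beta+\gamma}\,t_p\!\Big(\sqrt{\tfrac{\omega+1}{\beta}}(\boldsymbol{y}-\boldsymbol{\mu})\,\Big|\,\boldsymbol{0},\Omega,2\omega+2\Big)\,T_q\!\Big(\boldsymbol{m}\sqrt{\tfrac{p+2\omega+2}{2\beta+d(\boldsymbol{y})}}\,\Big|\,\boldsymbol{0},\Delta,p+2\omega+2\Big),$$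 where $\Omega=\Sigma+\Lambda\Lambda^{\top}$, $\Delta=\boldsymbol{I}_q-\Lambda^{\top}\Omega^{-1}\Lambda$, $\boldsymbol{m}=\Lambda^{\top}\Omega^{-1}(\boldsymbol{y}-\boldsymbol{\mu})$ and $d(\boldsymbol{y})=(\boldsymbol{y}-\boldsymbol{\mu})^{\top}\Omega^{-1}(\boldsymbol{y}-\boldsymbol{\mu})$.
   Context: $\Sigma^{1/2}$ is any matrix square root with $\Sigma^{1/2}(\Sigma^{1/2})^{\top}=\Sigma$. For $\nu>0$, $t_k(\boldsymbol{x}\mid\boldsymbol{0},S,\nu)=\frac{\Gamma((\nu+k)/2)}{(\nu\pi)^{k/2}\Gamma(\nu/2)|S|^{1/2}}\big[1+\boldsymbol{x}^{\top}S^{-1}\boldsymbol{x}/\nu\big]^{-(\nu+k)/2}$ is the $k$-dimensional Student's $t$ density with location $\boldsymbol{0}$, dispersion matrix $S$ and $\nu$ degrees of freedom, and $T_k(\boldsymbol{x}\mid\boldsymbol{0},S,\nu)=P(\boldsymbol{W}\le\boldsymbol{x})$ (componentwise) for $\boldsymbol{W}$ with density $t_k(\cdot\mid\boldsymbol{0},S,\nu)$ is the corresponding CDF. *)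

theory Defs
  imports "HOL-Probability.Probability"
begin

definition std_mvn_density :: "real^'n \<Rightarrow> real" where
  "std_mvn_density x = (\<Prod>i\<in>UNIV. std_normal_density (x $ i))"

definition gen_lindley_density :: "real \<Rightarrow> real \<Rightarrow> real \<Rightarrow> real \<Rightarrow> real" where
  "gen_lindley_density \<omega> \<beta> \<gamma> g =
     (if g > 0 then
        \<beta> powr (\<omega> + 1) * g powr (\<omega> - 1) * (\<omega> + \<gamma> * g)
          / ((\<beta> + \<gamma>) * Gamma (\<omega> + 1)) * exp (- \<beta> * g)
      else 0)"

definition mvt_density :: "real^'n^'n \<Rightarrow> real \<Rightarrow> real^'n \<Rightarrow> real" where
  "mvt_density S \<nu> x =
     Gamma ((\<nu> + real CARD('n)) / 2)
       / ((\<nu> * pi) powr (real CARD('n) / 2) * Gamma (\<nu> / 2) * sqrt (det S))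
     * (1 + (x \<bullet> (matrix_inv S *v x)) / \<nu>) powr (- (\<nu> + real CARD('n)) / 2)"

definition mvt_cdf :: "real^'n^'n \<Rightarrow> real \<Rightarrow> real^'n \<Rightarrow> real" where
  "mvt_cdf S \<nu> x =
     measure (density lborel (\<lambda>w. ennreal (mvt_density S \<nu> w))) {w. \<forall>i. w $ i \<le> x $ i}"

definition pos_def_mat :: "real^'n^'n \<Rightarrow> bool" where
  "pos_def_mat A \<longleftrightarrow> transpose A = A \<and> (\<forall>x. x \<noteq> 0 \<longrightarrow> x \<bullet> (A *v x) > 0)"

end

theory Submission
  imports Defs
begin

text \<open>
  Given \<open>G = g\<close>, substituting \<open>u = sqrt g w\<close> for \<open>u = |Z0|\<close> makes the joint density of \<open>(Y, w)\<close> a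
  power of \<open>g\<close> times \<open>exp (- g Q / 2)\<close> on the orthant \<open>w \<ge> 0\<close>, where completing the square gives
  \<open>Q = d(y) + (w - m) \<bullet> \<Delta>\<^sup>-\<^sup>1 (w - m)\<close>. Integrating out \<open>g\<close> against the Lindley density, a mixture of
  two gamma densities, turns the exponential into two powers of \<open>\<beta> + Q / 2\<close>. Each of them factors
  into a \<open>t\<close> density in \<open>y\<close> and, after rescaling \<open>m - w\<close>, a \<open>t\<close> density in the orthant variable, whose integral is
  the \<open>t\<close> distribution function; the constants agree because \<open>det \<Omega> det \<Delta> = det \<Sigma>\<close>.
\<close>

section \<open>Linear changes of variables\<close>

text \<open>Everything is a nonnegative integral in \<open>ennreal\<close>: the law of
  \<open>Y\<close> is tested against an arbitrary measurable \<open>k\<close>, so exchanging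
  integrals needs only measurability. The t densities are never shown to have mass 1; the finiteness
  required to reach the real-valued \<open>mvt_cdf\<close> is read off from the law of
  \<open>Y\<close>, which is a probability measure. The factor \<open>2 ^ q\<close> counts the
  orthants that the componentwise absolute value folds onto one. The determinant identity is
  obtained from volumes: the linear change of variables, needed anyway to pass from
  \<open>Z1\<close> to \<open>Y\<close>, also compares \<open>det (I + U V)\<close> with
  \<open>det (I + V U)\<close> up to sign, and positive definiteness settles the sign. Since
  \<open>S\<close> is an arbitrary root of \<open>\<Sigma>\<close>, it enters only through
  \<open>S ** transpose S = \<Sigma>\<close> and the Jacobian
  \<open>\<bar>det S\<bar>\<close>.\<close>

lemma prod_Basis_cart: "(\<Prod>b\<in>(Basis :: (real^'n) set). f b) = (\<Prod>i\<in>UNIV. f (axis i 1))"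
proof (rule prod.reindex_bij_betw[symmetric])
  show "bij_betw (\<lambda>i. axis i 1) UNIV (Basis :: (real^'n) set)"
    by (auto simp: bij_betw_def inj_on_def axis_eq_axis Basis_vec_def)
qed

text \<open>With all other coordinates frozen, a shear is a translation of coordinate
  \<open>m\<close>, and one-dimensional Lebesgue measure is translation invariant. The product form
  of \<open>lborel\<close> over the basis isolates that coordinate.\<close>

lemma nn_integral_lborel_shear:
  fixes h :: "real^'n \<Rightarrow> ennreal"
  assumes [measurable]: "h \<in> borel_measurable borel" and mn: "m \<noteq> n"
  shows "(\<integral>\<^sup>+x. h (\<chi> i. if i = m then x$m + x$n else x$i) \<partial>lborel) = (\<integral>\<^sup>+x. h x \<partial>lborel)"
proof -
  interpret product_sigma_finite "\<lambda>_::real^'n. lborel :: real measure" ..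
  let ?P = "\<Pi>\<^sub>M b\<in>(Basis::(real^'n) set). (lborel :: real measure)"
  let ?e = "\<lambda>i. axis i 1 :: real^'n"
  define \<phi> :: "((real^'n) \<Rightarrow> real) \<Rightarrow> real^'n" where "\<phi> f = (\<Sum>b\<in>Basis. f b *\<^sub>R b)" for f
  let ?B = "Basis - {?e m}"
  have B: "insert (?e m) ?B = Basis" by (auto simp: Basis_vec_def)
  have \<phi>_nth: "\<phi> f $ i = f (?e i)" for f i
  proof -
    have "\<phi> f $ i = \<phi> f \<bullet> ?e i" by (simp add: inner_axis)
    also have "\<dots> = f (?e i)" unfolding \<phi>_def by (subst inner_sum_left_Basis) (auto simp: axis_in_Basis_iff)
    finally show ?thesis .
  qed
  have em: "?e n \<noteq> ?e m" using mn by (metis axis_eq_axis one_neq_zero)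
  have [measurable]: "\<phi> \<in> borel_measurable ?P" unfolding \<phi>_def by measurable
  have lb: "lborel = distr ?P borel \<phi>" unfolding \<phi>_def by (rule lborel_eq)
  let ?T = "\<lambda>x::real^'n. \<chi> i. if i = m then x$m + x$n else x$i"
  have "continuous_on UNIV (\<lambda>x::real^'n. if i = m then x$m + x$n else x$i)" for i
    by (cases "i = m") (auto intro!: continuous_intros)
  then have "continuous_on UNIV ?T" by (intro continuous_on_vec_lambda)
  then have [measurable]: "?T \<in> borel_measurable borel" by (rule borel_measurable_continuous_onI)
  have fub: "(\<integral>\<^sup>+f. k (\<phi> f) \<partial>?P) = (\<integral>\<^sup>+f. (\<integral>\<^sup>+y. k (\<phi> (f(?e m := y))) \<partial>lborel) \<partial>(Pi\<^sub>M ?B (\<lambda>_. lborel)))"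
    if [measurable]: "k \<in> borel_measurable borel" for k :: "real^'n \<Rightarrow> ennreal"
    using product_nn_integral_insert[of ?B "?e m" "\<lambda>f. k (\<phi> f)"] unfolding B by simp
  \<comment> \<open>Coordinate \<open>n\<close> is untouched by the update because
    \<open>n \<noteq> m\<close>, so the shift does not depend on \<open>y\<close>. The factor
    \<open>1 * y\<close> fits the one-dimensional affine substitution applied below.\<close>
  have upd: "?T (\<phi> (f(?e m := y))) = \<phi> (f(?e m := f (?e n) + 1 * y))" for f y
    using em mn by (intro vec_eq_iff[THEN iffD2] allI) (simp add: \<phi>_nth axis_eq_axis)
  have "(\<integral>\<^sup>+x. h (?T x) \<partial>lborel) = (\<integral>\<^sup>+f. h (?T (\<phi> f)) \<partial>?P)"
    by (subst lb) (simp add: nn_integral_distr)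
  also have "\<dots> = (\<integral>\<^sup>+f. (\<integral>\<^sup>+y. h (?T (\<phi> (f(?e m := y)))) \<partial>lborel) \<partial>(Pi\<^sub>M ?B (\<lambda>_. lborel)))"
    by (rule fub) measurable
  also have "\<dots> = (\<integral>\<^sup>+f. (\<integral>\<^sup>+y. h (\<phi> (f(?e m := y))) \<partial>lborel) \<partial>(Pi\<^sub>M ?B (\<lambda>_. lborel)))"
  proof (rule nn_integral_cong)
    fix f assume f: "f \<in> space (Pi\<^sub>M ?B (\<lambda>_. lborel :: real measure))"
    have 1: "(\<lambda>y. f(?e m := y)) \<in> lborel \<rightarrow>\<^sub>M Pi\<^sub>M (insert (?e m) ?B) (\<lambda>_. lborel :: real measure)"
      by (rule measurable_fun_upd[where J = ?B]) (use f in auto)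
    then have [measurable]: "(\<lambda>y. f(?e m := y)) \<in> borel \<rightarrow>\<^sub>M ?P" unfolding B by simp
    have "(\<integral>\<^sup>+y. h (\<phi> (f(?e m := y))) \<partial>lborel) = (\<integral>\<^sup>+y. h (\<phi> (f(?e m := f (?e n) + 1 * y))) \<partial>lborel)"
      by (subst nn_integral_real_affine[where c = 1 and t = "f (?e n)"]) auto
    then show "(\<integral>\<^sup>+y. h (?T (\<phi> (f(?e m := y)))) \<partial>lborel) = (\<integral>\<^sup>+y. h (\<phi> (f(?e m := y))) \<partial>lborel)"
      by (simp only: upd)
  qed
  also have "\<dots> = (\<integral>\<^sup>+f. h (\<phi> f) \<partial>?P)" by (rule fub[symmetric]) measurable
  also have "\<dots> = (\<integral>\<^sup>+x. h x \<partial>lborel)"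
    by (subst lb) (simp add: nn_integral_distr)
  finally show ?thesis .
qed

lemma borel_measurable_matrix_vector_mult [measurable]:
  fixes A :: "real^'n^'m"
  assumes "f \<in> borel_measurable N"
  shows "(\<lambda>x. A *v f x) \<in> borel_measurable N"
  by (rule measurable_compose[OF assms])
     (intro borel_measurable_continuous_onI linear_continuous_on matrix_vector_mul_bounded_linear)

lemma borel_measurable_vec_nth [measurable]:
  fixes f :: "'a \<Rightarrow> real^'n"
  assumes "f \<in> borel_measurable N"
  shows "(\<lambda>x. f x $ i) \<in> borel_measurable N"
  by (rule measurable_compose[OF assms])
     (intro borel_measurable_continuous_onI continuous_intros)

lemma borel_measurable_vec_lambda [measurable]:
  fixes f :: "'n::finite \<Rightarrow> 'a \<Rightarrow> real"
  assumes "\<And>i. f i \<in> borel_measurable N"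
  shows "(\<lambda>x. \<chi> i. f i x) \<in> borel_measurable N"
proof (subst borel_measurable_iff_halfspace_le, safe)
  show "{w \<in> space N. (\<chi> i. f i w) \<bullet> b \<le> a} \<in> sets N" if "b \<in> Basis" for b :: "real^'n" and a
  proof -
    from that obtain i where "b = axis i 1" by (auto simp: Basis_vec_def)
    then have "{w \<in> space N. (\<chi> i. f i w) \<bullet> b \<le> a} = {w \<in> space N. f i w \<le> a}" by (simp add: inner_axis)
    also have "\<dots> \<in> sets N" using assms[of i] by measurable
    finally show ?thesis .
  qed
qed

lemma nn_integral_lborel_stretch:
  fixes h :: "real^'n \<Rightarrow> ennreal"
  assumes [measurable]: "h \<in> borel_measurable borel" and c: "\<And>i. c i \<noteq> 0"
  shows "(\<integral>\<^sup>+x. h x \<partial>lborel) = ennreal \<bar>\<Prod>i\<in>UNIV. c i\<bar> * (\<integral>\<^sup>+x. h (\<chi> i. c i * x$i) \<partial>lborel)"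
proof -
  \<comment> \<open>The affine rule for Euclidean spaces takes its scaling factors indexed by basis
    vectors; \<open>k\<close> transports \<open>c\<close> to that indexing.\<close>
  define k where "k b = c (THE i. b = axis i (1::real))" for b :: "real^'n"
  have k: "k (axis i 1) = c i" for i unfolding k_def by (simp add: axis_eq_axis)
  let ?T = "\<lambda>x::real^'n. \<chi> i. c i * x$i"
  have T: "0 + (\<Sum>j\<in>Basis. (k j * (x \<bullet> j)) *\<^sub>R j) = ?T x" (is "0 + ?s = _") for x
  proof -
    have "?s $ i = c i * x$i" for i
    proof -
      have "?s $ i = ?s \<bullet> axis i 1" by (simp add: inner_axis)
      also have "\<dots> = c i * x$i" 
        by (subst inner_sum_left_Basis) (auto simp: axis_in_Basis_iff k inner_axis)
      finally show ?thesis .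
    qed
    then show ?thesis by (simp add: vec_eq_iff)
  qed
  have pr: "(\<Prod>j\<in>Basis. \<bar>k j\<bar>) = \<bar>\<Prod>i\<in>UNIV. c i\<bar>"
    by (simp add: prod_Basis_cart k abs_prod)
  have "lborel = density (distr lborel borel (\<lambda>x. 0 + (\<Sum>j\<in>Basis. (k j * (x \<bullet> j)) *\<^sub>R j))) (\<lambda>_. (\<Prod>j\<in>Basis. \<bar>k j\<bar>))"
    by (rule lborel_affine_euclidean) (auto simp: Basis_vec_def k c)
  then have "lborel = density (distr lborel borel ?T) (\<lambda>_. \<bar>\<Prod>i\<in>UNIV. c i\<bar>)"
    unfolding T pr .
  then have "(\<integral>\<^sup>+x. h x \<partial>lborel) = (\<integral>\<^sup>+x. h x \<partial>density (distr lborel borel ?T) (\<lambda>_. \<bar>\<Prod>i\<in>UNIV. c i\<bar>))"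
    by simp
  also have "\<dots> = ennreal \<bar>\<Prod>i\<in>UNIV. c i\<bar> * (\<integral>\<^sup>+x. h (?T x) \<partial>lborel)"
    by (simp add: nn_integral_density nn_integral_distr nn_integral_cmult)
  finally show ?thesis .
qed

text \<open>Lebesgue measure is determined by its values on boxes, and a coordinate swap pulls a box
  back to a box with the same side lengths in another order.\<close>

lemma nn_integral_lborel_transpose:
  fixes h :: "real^'n \<Rightarrow> ennreal"
  assumes [measurable]: "h \<in> borel_measurable borel"
  shows "(\<integral>\<^sup>+x. h (\<chi> i. x $ Transposition.transpose m n i) \<partial>lborel) = (\<integral>\<^sup>+x. h x \<partial>lborel)"
proof -
  let ?t = "Transposition.transpose m n"
  let ?T = "\<lambda>x::real^'n. \<chi> i. x $ ?t i"
  have "lborel = distr lborel borel ?T"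
  proof (rule lborel_eqI)
    fix l u :: "real^'n" assume le: "\<And>b. b \<in> Basis \<Longrightarrow> l \<bullet> b \<le> u \<bullet> b"
    then have le': "l $ i \<le> u $ i" for i
      using le[of "axis i 1"] by (simp add: inner_axis axis_in_Basis_iff)
    have "(\<forall>i. l $ i < x $ ?t i \<and> x $ ?t i < u $ i) \<longleftrightarrow> (\<forall>i. l $ ?t i < x $ i \<and> x $ i < u $ ?t i)" for x :: "real^'n"
      by (metis transpose_involutory)
    then have "?T -` box l u = box (?T l) (?T u)"
      by (simp add: mem_box_cart set_eq_iff)
    then have "emeasure (distr lborel borel ?T) (box l u) = emeasure lborel (box (?T l) (?T u))"
      by (simp add: emeasure_distr)
    also have "\<dots> = ennreal (\<Prod>i\<in>UNIV. u $ ?t i - l $ ?t i)"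
    proof (subst emeasure_lborel_box)
      show "?T l \<bullet> b \<le> ?T u \<bullet> b" if "b \<in> Basis" for b
        using le' that by (auto simp: Basis_vec_def inner_axis)
    qed (simp add: prod_Basis_cart inner_axis inner_diff_left)
    also have "(\<Prod>i\<in>UNIV. u $ ?t i - l $ ?t i) = (\<Prod>i\<in>UNIV. u $ i - l $ i)"
      by (rule prod.reindex_bij_betw[of ?t UNIV UNIV "\<lambda>i. u $ i - l $ i"]) simp
    also have "\<dots> = (\<Prod>b\<in>Basis. (u - l) \<bullet> b)"
      by (simp add: prod_Basis_cart inner_axis inner_diff_left)
    finally show "emeasure (distr lborel borel ?T) (box l u) = (\<Prod>b\<in>Basis. (u - l) \<bullet> b)" .
  qed simp
  then have "(\<integral>\<^sup>+x. h x \<partial>lborel) = (\<integral>\<^sup>+x. h x \<partial>distr lborel borel ?T)" by simp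
  also have "\<dots> = (\<integral>\<^sup>+x. h (?T x) \<partial>lborel)" by (simp add: nn_integral_distr)
  finally show ?thesis by simp
qed

text \<open>Both sides are multiplicative in \<open>A\<close>, so it suffices to treat elementary
  matrices: diagonal ones, swaps and shears. Matrices with a zero row are excluded by
  \<open>det A \<noteq> 0\<close>.\<close>

theorem nn_integral_lborel_linear:
  fixes h :: "real^'n \<Rightarrow> ennreal"
  assumes "h \<in> borel_measurable borel" and "det A \<noteq> 0"
  shows "(\<integral>\<^sup>+x. h x \<partial>lborel) = ennreal \<bar>det A\<bar> * (\<integral>\<^sup>+x. h (A *v x) \<partial>lborel)"
proof -
  \<comment> \<open>The quantifier over \<open>h\<close> sits inside the predicate because the
    product case applies the claim for \<open>B\<close> to \<open>h\<close> composed with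
    \<open>A\<close>.\<close>
  let ?Q = "\<lambda>A::real^'n^'n. det A \<noteq> 0 \<longrightarrow> (\<forall>h\<in>borel_measurable borel. 
     (\<integral>\<^sup>+x. h x \<partial>lborel) = ennreal \<bar>det A\<bar> * (\<integral>\<^sup>+x. h (A *v x) \<partial>lborel))"
  have "?Q A"
  proof (rule induct_matrix_elementary_alt[where P = ?Q])
    fix A B :: "real^'n^'n"
    assume A: "?Q A" and B: "?Q B"
    show "?Q (A ** B)"
    proof (intro impI ballI)
      fix h :: "real^'n \<Rightarrow> ennreal"
      assume d: "det (A ** B) \<noteq> 0" and [measurable]: "h \<in> borel_measurable borel"
      have dA: "det A \<noteq> 0" and dB: "det B \<noteq> 0" using d by (auto simp: det_mul)
      have "(\<integral>\<^sup>+x. h x \<partial>lborel) = ennreal \<bar>det A\<bar> * (\<integral>\<^sup>+x. h (A *v x) \<partial>lborel)"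
        by (rule A[rule_format, OF dA]) measurable
      also have "(\<integral>\<^sup>+x. h (A *v x) \<partial>lborel) = ennreal \<bar>det B\<bar> * (\<integral>\<^sup>+x. h (A *v (B *v x)) \<partial>lborel)"
        by (rule B[rule_format, OF dB]) measurable
      finally show "(\<integral>\<^sup>+x. h x \<partial>lborel) = ennreal \<bar>det (A ** B)\<bar> * (\<integral>\<^sup>+x. h ((A ** B) *v x) \<partial>lborel)"
        by (simp add: matrix_vector_mul_assoc det_mul abs_mult ennreal_mult mult.assoc)
    qed
  next
    fix A :: "real^'n^'n" and i assume "row i A = 0"
    then show "?Q A" by (simp add: det_zero_row)
  next
    fix A :: "real^'n^'n" assume 0: "\<And>i j. i \<noteq> j \<Longrightarrow> A$i$j = 0"
    have "A $ i $ i * x $ i = (\<Sum>j\<in>UNIV. A $ i $ j * x $ j)" for x and i :: "'n"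
      by (simp add: 0 comm_monoid_add_class.sum.remove [where x=i])
    then have A: "A *v x = (\<chi> i. A $ i $ i * x $ i)" for x
      by (auto simp: 0 matrix_vector_mult_def)
    have d: "det A = (\<Prod>i\<in>UNIV. A $ i $ i)" using 0 by (rule det_diagonal)
    show "?Q A"
      unfolding A d by (intro impI ballI nn_integral_lborel_stretch) auto
  next
    fix m n :: 'n assume "m \<noteq> n"
    let ?A = "(\<chi> i j. mat 1 $ i $ Transposition.transpose m n j) :: real^'n^'n"
    have "det ?A = of_int (sign (Transposition.transpose m n)) * det (mat 1 :: real^'n^'n)"
      by (rule det_permute_columns) (simp add: permutes_swap_id)
    then have d: "\<bar>det ?A\<bar> = 1" using \<open>m \<noteq> n\<close> by (simp add: sign_swap_id)
    have eq: "(\<Sum>j\<in>UNIV. if i = Transposition.transpose m n j then x $ j else 0) =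
              (\<Sum>j\<in>UNIV. if j = Transposition.transpose m n i then x $ j else 0)"
      for i and x :: "real^'n"
      by (rule sum.cong) (auto simp add: swap_id_eq)
    have A: "?A *v x = (\<chi> i. x $ Transposition.transpose m n i)" for x
      by (auto simp: mat_def matrix_vector_mult_def eq if_distrib [of "\<lambda>x. x * y" for y] cong: if_cong)
    show "?Q ?A" unfolding d A by (simp add: nn_integral_lborel_transpose)
  next
    fix m n :: 'n assume mn: "m \<noteq> n"
    let ?A = "(\<chi> i j. of_bool (i = m \<and> j = n \<or> i = j)) :: real^'n^'n"
    have d: "det ?A = 1"
    proof -
      have "?A = (\<chi> k. if k = m then row m (mat 1) + 1 *s row n (mat 1) else row k (mat 1))"
        using mn by (auto simp: vec_eq_iff row_def mat_def)
      then show ?thesis using det_row_operation[OF mn, where A = "mat 1 :: real^'n^'n" and c = 1] by (simp only: det_I)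
    qed
    have "x $ m + x $ n = (\<Sum>j\<in>UNIV. of_bool (j = n \<or> m = j) * x $ j)" for x :: "real^'n"
      using mn by (auto simp: of_bool_def if_distrib [of "\<lambda>x. x * y" for y] sum.remove cong: if_cong)
    then have A: "?A *v x = (\<chi> i. if i = m then x $ m + x $ n else x $ i)" for x
      unfolding matrix_vector_mult_def of_bool_def
      by (auto simp: vec_eq_iff if_distrib [of "\<lambda>x. x * y" for y] cong: if_cong)
    show "?Q ?A" unfolding d A using mn by (simp add: nn_integral_lborel_shear)
  qed
  then show ?thesis using assms by blast
qed

lemma nn_integral_lborel_affine:
  fixes h :: "'a::euclidean_space \<Rightarrow> ennreal"
  assumes [measurable]: "h \<in> borel_measurable borel" and c: "c \<noteq> 0"
  shows "(\<integral>\<^sup>+x. h x \<partial>lborel) = ennreal (\<bar>c\<bar> ^ DIM('a)) * (\<integral>\<^sup>+x. h (t + c *\<^sub>R x) \<partial>lborel)"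
  by (subst lborel_affine[OF c, of t])
     (simp add: nn_integral_density nn_integral_distr nn_integral_cmult)

section \<open>Positive definite matrices and determinants\<close>

lemma pos_def_mat_det_nz:
  assumes "pos_def_mat (A::real^'n^'n)"
  shows "det A \<noteq> 0"
proof
  assume "det A = 0"
  then obtain x where "x \<noteq> 0" "A *v x = 0"
    by (metis invertible_det_nz invertible_left_inverse matrix_left_invertible_ker)
  then show False using assms by (auto simp: pos_def_mat_def)
qed

lemma pos_def_mat_add:
  assumes "pos_def_mat A" "transpose B = B" "\<And>x. x \<bullet> (B *v x) \<ge> 0"
  shows "pos_def_mat (A + B)"
  unfolding pos_def_mat_def
proof safe
  show "transpose (A + B) = A + B"
    using assms by (simp add: pos_def_mat_def transpose_def vec_eq_iff)
  show "0 < x \<bullet> ((A + B) *v x)" if "x \<noteq> 0" for x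
    using assms(1) assms(3)[of x] that
    by (simp add: pos_def_mat_def matrix_vector_mult_add_rdistrib inner_add_right add_pos_nonneg)
qed

lemma pos_def_mat_1: "pos_def_mat (mat 1 :: real^'n^'n)"
  by (simp add: pos_def_mat_def)

lemma pos_def_mat_scaleR: "pos_def_mat A \<Longrightarrow> c > 0 \<Longrightarrow> pos_def_mat (c *\<^sub>R A)"
  unfolding pos_def_mat_def
  by (simp add: scaleR_matrix_vector_assoc[symmetric] transpose_def vec_eq_iff)

text \<open>The segment from the identity to \<open>A\<close> stays positive definite, so the
  determinant is continuous and nowhere zero on it and cannot change the sign it has at the
  identity.\<close>

lemma pos_def_mat_det_pos:
  assumes A: "pos_def_mat (A::real^'n^'n)"
  shows "det A > 0"
proof (rule ccontr)
  assume "\<not> det A > 0"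
  let ?f = "\<lambda>t. det ((1 - t) *\<^sub>R mat 1 + t *\<^sub>R A)"
  have "continuous_on {0..1} ?f" unfolding det_def by (auto intro!: continuous_intros)
  then obtain t where t: "0 \<le> t" "t \<le> 1" "?f t = 0"
    using IVT2'[of ?f 1 0 0] \<open>\<not> det A > 0\<close> by auto
  have "pos_def_mat ((1 - t) *\<^sub>R mat 1 + t *\<^sub>R A)"
  \<comment> \<open>At \<open>t = 1\<close> the strictly positive summand
    \<open>(1 - t) *\<^sub>R mat 1\<close> vanishes, but the matrix is then \<open>A\<close>
    itself.\<close>
  proof (cases "t = 1")
    case False
    have "x \<bullet> (A *v x) \<ge> 0" for x using A by (cases "x = 0") (auto simp: pos_def_mat_def less_imp_le)
    then show ?thesis using False t A
      by (intro pos_def_mat_add pos_def_mat_scaleR pos_def_mat_1)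
         (auto simp: pos_def_mat_def transpose_def vec_eq_iff scaleR_matrix_vector_assoc[symmetric])
  qed (simp add: A)
  from pos_def_mat_det_nz[OF this] t show False by simp
qed

lemma nn_integral_lborel_translate:
  fixes h :: "'a::euclidean_space \<Rightarrow> ennreal"
  assumes "h \<in> borel_measurable borel"
  shows "(\<integral>\<^sup>+x. h x \<partial>lborel) = (\<integral>\<^sup>+x. h (t + x) \<partial>lborel)"
  using nn_integral_lborel_affine[OF assms, of 1 t] by simp

text \<open>Both determinants measure the volume distortion of the block matrix with rows
  \<open>(I, -U)\<close> and \<open>(V, I)\<close>, which factors into block triangular matrices in two ways.\<close>

lemma abs_det_sylvester:
  fixes U :: "real^'q^'p" and V :: "real^'p^'q"
  assumes d1: "det (mat 1 + U ** V) \<noteq> 0" and d2: "det (mat 1 + V ** U) \<noteq> 0"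
  shows "\<bar>det (mat 1 + U ** V)\<bar> = \<bar>det (mat 1 + V ** U)\<bar>"
proof -
  \<comment> \<open>A test function with integral 1: the indicator of a product of unit
    cubes.\<close>
  define h :: "(real^'p) \<Rightarrow> (real^'q) \<Rightarrow> ennreal"
    where "h x w = indicator (cbox 0 (\<chi> i. 1)) x * indicator (cbox 0 (\<chi> i. 1)) w" for x w
  have [measurable]: "case_prod h \<in> borel_measurable (borel \<Otimes>\<^sub>M borel)"
    unfolding h_def split_beta' by measurable
  have h[measurable (raw)]: "(\<lambda>z. h (f z) (g z)) \<in> borel_measurable N"
    if [measurable]: "f \<in> borel_measurable N" "g \<in> borel_measurable N" for f g and N :: "'z measure"
    unfolding h_def by measurable
  \<comment> \<open>\<open>J\<close> is the integral of \<open>h\<close> along the block map. It is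
    reached twice from the integral of \<open>h\<close>, by shears that preserve volume and by one
    linear substitution, with \<open>?A\<close> in the first variable or with \<open>?B\<close> in
    the second.\<close>
  define J where "J = (\<integral>\<^sup>+x. \<integral>\<^sup>+w. h (x - U *v w) (V *v x + w) \<partial>lborel \<partial>lborel)"
  let ?A = "mat 1 + U ** V" and ?B = "mat 1 + V ** U"
  have unit: "emeasure lborel (cbox 0 (\<chi> i. 1) :: (real^'n) set) = 1"
  proof (subst emeasure_lborel_cbox)
    show "0 \<bullet> b \<le> (\<chi> i. 1) \<bullet> b" if "b \<in> Basis" for b :: "real^'n"
      using that by (auto simp: Basis_vec_def inner_axis)
  qed (simp add: prod_Basis_cart inner_axis)
  have one: "(\<integral>\<^sup>+x. \<integral>\<^sup>+w. h x w \<partial>lborel \<partial>lborel) = 1"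
    unfolding h_def by (simp add: nn_integral_cmult unit)
  have A: "?A *v x - U *v (V *v x + w) = x - U *v w" for x w
    by (simp add: algebra_simps matrix_vector_mul_assoc[symmetric] matrix_vector_right_distrib matrix_vector_mult_add_rdistrib)
  have B: "V *v (- (U *v w) + x) + ?B *v w = V *v x + w" for x w
    by (simp add: algebra_simps matrix_vector_mul_assoc[symmetric] matrix_vector_right_distrib matrix_vector_mult_add_rdistrib
         matrix_vector_mult_diff_distrib)
  have "1 = (\<integral>\<^sup>+w. \<integral>\<^sup>+x. h x w \<partial>lborel \<partial>lborel)"
    unfolding one[symmetric] by (rule lborel_pair.Fubini'[symmetric]) measurable
  also have "\<dots> = (\<integral>\<^sup>+w. \<integral>\<^sup>+x. h (- (U *v w) + x) w \<partial>lborel \<partial>lborel)"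
    by (intro nn_integral_cong nn_integral_lborel_translate) measurable
  also have "\<dots> = (\<integral>\<^sup>+w. ennreal \<bar>det ?A\<bar> * (\<integral>\<^sup>+x. h (- (U *v w) + ?A *v x) w \<partial>lborel) \<partial>lborel)"
    by (intro nn_integral_cong nn_integral_lborel_linear d1) measurable
  also have "\<dots> = ennreal \<bar>det ?A\<bar> * (\<integral>\<^sup>+w. (\<integral>\<^sup>+x. h (- (U *v w) + ?A *v x) w \<partial>lborel) \<partial>lborel)"
    by (rule nn_integral_cmult) measurable
  also have "(\<integral>\<^sup>+w. (\<integral>\<^sup>+x. h (- (U *v w) + ?A *v x) w \<partial>lborel) \<partial>lborel)
      = (\<integral>\<^sup>+x. (\<integral>\<^sup>+w. h (- (U *v w) + ?A *v x) w \<partial>lborel) \<partial>lborel)"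
    by (rule lborel_pair.Fubini'[symmetric]) measurable
  also have "\<dots> = (\<integral>\<^sup>+x. (\<integral>\<^sup>+w. h (- (U *v (V *v x + w)) + ?A *v x) (V *v x + w) \<partial>lborel) \<partial>lborel)"
    by (intro nn_integral_cong nn_integral_lborel_translate) measurable
  also have "\<dots> = J" unfolding J_def by (simp add: A)
  finally have 1: "1 = ennreal \<bar>det ?A\<bar> * J" .
  have "1 = (\<integral>\<^sup>+x. \<integral>\<^sup>+w. h x (V *v x + w) \<partial>lborel \<partial>lborel)"
    unfolding one[symmetric] by (intro nn_integral_cong nn_integral_lborel_translate) measurable
  also have "\<dots> = (\<integral>\<^sup>+x. ennreal \<bar>det ?B\<bar> * (\<integral>\<^sup>+w. h x (V *v x + ?B *v w) \<partial>lborel) \<partial>lborel)"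
    by (intro nn_integral_cong nn_integral_lborel_linear d2) measurable
  also have "\<dots> = ennreal \<bar>det ?B\<bar> * (\<integral>\<^sup>+x. (\<integral>\<^sup>+w. h x (V *v x + ?B *v w) \<partial>lborel) \<partial>lborel)"
    by (rule nn_integral_cmult) measurable
  also have "(\<integral>\<^sup>+x. (\<integral>\<^sup>+w. h x (V *v x + ?B *v w) \<partial>lborel) \<partial>lborel)
      = (\<integral>\<^sup>+w. (\<integral>\<^sup>+x. h x (V *v x + ?B *v w) \<partial>lborel) \<partial>lborel)"
    by (rule lborel_pair.Fubini') measurable
  also have "\<dots> = (\<integral>\<^sup>+w. (\<integral>\<^sup>+x. h (- (U *v w) + x) (V *v (- (U *v w) + x) + ?B *v w) \<partial>lborel) \<partial>lborel)"
    by (intro nn_integral_cong nn_integral_lborel_translate) measurable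
  also have "\<dots> = (\<integral>\<^sup>+w. (\<integral>\<^sup>+x. h (x - U *v w) (V *v x + w) \<partial>lborel) \<partial>lborel)"
    by (simp only: B) simp
  also have "\<dots> = J" unfolding J_def by (rule lborel_pair.Fubini'[symmetric]) measurable
  finally have 2: "1 = ennreal \<bar>det ?B\<bar> * J" .
  \<comment> \<open>A product with a nonzero finite factor equals 1, so \<open>J\<close> is positive
    and finite and can be cancelled.\<close>
  have "J \<noteq> \<top>" "J \<noteq> 0" using 1 d1 by (auto simp: ennreal_mult_top)
  then obtain r where r: "J = ennreal r" "r > 0" by (cases J) (auto simp: ennreal_eq_0_iff not_le)
  from 1 r have "\<bar>det ?A\<bar> * r = 1" by (metis abs_ge_zero ennreal_1 ennreal_inj ennreal_mult' less_imp_le mult_nonneg_nonneg zero_le_one)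
  moreover from 2 r have "\<bar>det ?B\<bar> * r = 1" by (metis abs_ge_zero ennreal_1 ennreal_inj ennreal_mult' less_imp_le mult_nonneg_nonneg zero_le_one)
  ultimately show ?thesis using r by (metis less_irrefl mult_right_cancel)
qed

section \<open>Folding, gamma integrals and independent triples\<close>

lemma AE_lborel_vec_nth_nz: "AE x in lborel :: (real^'n) measure. x $ i \<noteq> 0"
proof (rule AE_I')
  have m: "{x::real^'n. x $ i = 0} \<in> sets lborel"
    by measurable
  have "negligible {x::real^'n. x $ i = 0}"
    by (rule negligible_standard_hyperplane_cart)
  then show "{x::real^'n. x $ i = 0} \<in> null_sets lborel"
    using m by (simp add: negligible_iff_null_sets null_sets_completion_iff)
qed auto

text \<open>Coordinates are folded one at a time. Reflecting coordinate \<open>j\<close> preserves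
  the measure and an integrand that sees only absolute values, so the two half spaces contribute
  equally and each coordinate yields a factor 2.\<close>

lemma nn_integral_lborel_abs_components:
  fixes h :: "real^'n \<Rightarrow> ennreal"
  assumes [measurable]: "h \<in> borel_measurable borel"
  shows "(\<integral>\<^sup>+z. h (\<chi> i. \<bar>z $ i\<bar>) \<partial>lborel)
    = 2 ^ CARD('n) * (\<integral>\<^sup>+z. h z * indicator {z. \<forall>i. 0 \<le> z $ i} z \<partial>lborel)"
proof -
  have partial: "(\<integral>\<^sup>+z. h (\<chi> i. \<bar>z $ i\<bar>) \<partial>lborel)
    = 2 ^ card I * (\<integral>\<^sup>+z. h (\<chi> i. \<bar>z $ i\<bar>) * indicator {z. \<forall>i\<in>I. 0 \<le> z $ i} z \<partial>lborel)" if "finite I" for I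
    using that
  proof (induction I rule: finite_induct)
    case (insert j I)
    let ?k = "\<lambda>z::real^'n. h (\<chi> i. \<bar>z $ i\<bar>) * indicator {z. \<forall>i\<in>I. 0 \<le> z $ i} z"
    let ?r = "\<lambda>z::real^'n. \<chi> i. (if i = j then - 1 else 1) * z $ i"
    have [measurable]: "?k \<in> borel_measurable borel" using insert(1) by measurable
    have k: "?k (?r z) = ?k z" for z
    proof -
      have "(\<chi> i. \<bar>?r z $ i\<bar>) = (\<chi> i. \<bar>z $ i\<bar>)" by (simp add: vec_eq_iff)
      moreover have "(\<forall>i\<in>I. 0 \<le> ?r z $ i) \<longleftrightarrow> (\<forall>i\<in>I. 0 \<le> z $ i)" using insert(2) by auto
      ultimately show ?thesis by (simp only: indicator_def mem_Collect_eq)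
    qed
    have "(\<integral>\<^sup>+z. ?k z \<partial>lborel) = (\<integral>\<^sup>+z. ?k z * indicator {z. 0 \<le> z $ j} z + ?k z * indicator {z. z $ j < 0} z \<partial>lborel)"
      by (rule nn_integral_cong) (auto split: split_indicator)
    also have "\<dots> = (\<integral>\<^sup>+z. ?k z * indicator {z. 0 \<le> z $ j} z \<partial>lborel) + (\<integral>\<^sup>+z. ?k z * indicator {z. z $ j < 0} z \<partial>lborel)"
      by (rule nn_integral_add) measurable
    also have "(\<integral>\<^sup>+z. ?k z * indicator {z. z $ j < 0} z \<partial>lborel)
        = ennreal \<bar>\<Prod>i\<in>UNIV. (if i = j then - 1 else 1)\<bar> * (\<integral>\<^sup>+z. ?k (?r z) * indicator {z. z $ j < 0} (?r z) \<partial>lborel)"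
    proof (rule nn_integral_lborel_stretch[where c = "\<lambda>i. if i = j then - 1 else 1" and h = "\<lambda>z. ?k z * indicator {z. z $ j < 0} z"])
      show "(\<lambda>z. ?k z * indicator {z. z $ j < 0} z) \<in> borel_measurable borel" by measurable
    qed simp
    also have "\<dots> = (\<integral>\<^sup>+z. ?k z * indicator {z. - (z $ j) < 0} z \<partial>lborel)"
      unfolding k by (simp add: indicator_def)
    \<comment> \<open>The reflected half space is open and the other one closed; they differ by a
      null hyperplane.\<close>
    also have "\<dots> = (\<integral>\<^sup>+z. ?k z * indicator {z. 0 \<le> z $ j} z \<partial>lborel)"
      by (rule nn_integral_cong_AE) (use AE_lborel_vec_nth_nz[of j] in eventually_elim, auto simp: indicator_def)
    also have "(\<integral>\<^sup>+z. ?k z * indicator {z. 0 \<le> z $ j} z \<partial>lborel)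
       = (\<integral>\<^sup>+z. h (\<chi> i. \<bar>z $ i\<bar>) * indicator {z. \<forall>i\<in>insert j I. 0 \<le> z $ i} z \<partial>lborel)"
      by (rule nn_integral_cong) (auto split: split_indicator)
    finally have double: "(\<integral>\<^sup>+z. ?k z \<partial>lborel)
       = 2 * (\<integral>\<^sup>+z. h (\<chi> i. \<bar>z $ i\<bar>) * indicator {z. \<forall>i\<in>insert j I. 0 \<le> z $ i} z \<partial>lborel)"
      by (simp only: mult_2)
    show ?case
      unfolding insert.IH double using insert(1,2) by (simp add: ac_simps)
  qed simp
  have "(\<integral>\<^sup>+z. h (\<chi> i. \<bar>z $ i\<bar>) * indicator {z. \<forall>i\<in>UNIV. 0 \<le> z $ i} z \<partial>lborel)
      = (\<integral>\<^sup>+z. h z * indicator {z. \<forall>i. 0 \<le> z $ i} z \<partial>lborel)"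
  proof (rule nn_integral_cong)
    fix z :: "real^'n"
    show "h (\<chi> i. \<bar>z $ i\<bar>) * indicator {z. \<forall>i\<in>UNIV. 0 \<le> z $ i} z = h z * indicator {z. \<forall>i. 0 \<le> z $ i} z"
    proof (cases "\<forall>i. 0 \<le> z $ i")
      case True
      then have "(\<chi> i. \<bar>z $ i\<bar>) = z" by (simp add: vec_eq_iff)
      then show ?thesis by simp
    qed (simp add: indicator_def)
  qed
  with partial[of UNIV] show ?thesis by simp
qed

text \<open>Euler's integral under the substitution \<open>b * g\<close>. The two integrands agree
  also at \<open>g = 0\<close>, where the closed and the open half line differ, because
  \<open>0 powr x = 0\<close>.\<close>

lemma nn_integral_gamma:
  assumes a: "a > 0" and b: "b > 0"
  shows "(\<integral>\<^sup>+g. ennreal (indicator {0<..} g * g powr (a - 1) * exp (- b * g)) \<partial>lborel) = ennreal (Gamma a / b powr a)"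
    (is "?I = _")
proof -
  have "ennreal (Gamma a) = ennreal \<bar>b\<bar> * (\<integral>\<^sup>+g. ennreal (indicator {0..} (0 + b * g) * (0 + b * g) powr (a - 1) / exp (0 + b * g)) \<partial>lborel)"
    unfolding Gamma_conv_nn_integral_real[OF a] using b
    by (intro nn_integral_real_affine) auto
  also have "\<dots> = (\<integral>\<^sup>+g. ennreal b * ennreal (indicator {0..} (0 + b * g) * (0 + b * g) powr (a - 1) / exp (0 + b * g)) \<partial>lborel)"
    using b by (simp add: nn_integral_cmult)
  also have "\<dots> = (\<integral>\<^sup>+g. ennreal (b powr a) * ennreal (indicator {0<..} g * g powr (a - 1) * exp (- b * g)) \<partial>lborel)"
  proof (rule nn_integral_cong)
    fix g :: real
    show "ennreal b * ennreal (indicator {0..} (0 + b * g) * (0 + b * g) powr (a - 1) / exp (0 + b * g))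
      = ennreal (b powr a) * ennreal (indicator {0<..} g * g powr (a - 1) * exp (- b * g))"
    proof (cases "g > 0")
      case True
      have "b * ((b * g) powr (a - 1) / exp (b * g)) = b powr a * (g powr (a - 1) * exp (- b * g))"
        using True b by (simp add: powr_mult powr_diff exp_minus field_simps)
      then show ?thesis using True b by (simp add: ennreal_mult'[symmetric])
    next
      case False
      then show ?thesis using b by (cases "g = 0") (auto simp: indicator_def zero_le_mult_iff)
    qed
  qed
  also have "\<dots> = ennreal (b powr a) * ?I"
    by (rule nn_integral_cmult) measurable
  finally have *: "ennreal (Gamma a) = ennreal (b powr a) * ?I" .
  have "ennreal (Gamma a / b powr a) = ennreal (1 / b powr a) * ennreal (Gamma a)"
    using b by (simp add: ennreal_mult'[symmetric])
  also have "\<dots> = (ennreal (1 / b powr a) * ennreal (b powr a)) * ?I"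
    by (simp only: * mult.assoc)
  also have "ennreal (1 / b powr a) * ennreal (b powr a) = 1"
    using b by (simp add: ennreal_mult'[symmetric])
  finally show ?thesis by simp
qed

text \<open>Independence on rectangles makes the joint law a product measure, whose integrals unfold
  into iterated ones weighted by the three densities.\<close>

lemma (in prob_space) nn_integral_indep_triple:
  assumes X: "distributed M S X f" and Y: "distributed M T Y g" and Z: "distributed M U Z h"
    and sf: "sigma_finite_measure S" "sigma_finite_measure T" "sigma_finite_measure U"
    and indep: "\<And>A B C. A \<in> sets S \<Longrightarrow> B \<in> sets T \<Longrightarrow> C \<in> sets U \<Longrightarrow>
      prob (X -` A \<inter> Y -` B \<inter> Z -` C \<inter> space M)
       = prob (X -` A \<inter> space M) * prob (Y -` B \<inter> space M) * prob (Z -` C \<inter> space M)"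
    and H: "H \<in> borel_measurable (S \<Otimes>\<^sub>M (T \<Otimes>\<^sub>M U))"
  shows "(\<integral>\<^sup>+\<omega>. H (X \<omega>, Y \<omega>, Z \<omega>) \<partial>M)
    = (\<integral>\<^sup>+x. f x * (\<integral>\<^sup>+y. g y * (\<integral>\<^sup>+z. h z * H (x, y, z) \<partial>U) \<partial>T) \<partial>S)"
proof -
  note [measurable] = distributed_measurable[OF X] distributed_measurable[OF Y] distributed_measurable[OF Z]
    distributed_borel_measurable[OF X] distributed_borel_measurable[OF Y] distributed_borel_measurable[OF Z] H
  interpret S: sigma_finite_measure S by fact
  interpret T: sigma_finite_measure T by fact
  interpret U: sigma_finite_measure U by fact
  define P where "P = distr M S X"
  define Q where "Q = distr M T Y"
  define R where "R = distr M U Z"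
  interpret P: prob_space P unfolding P_def by (rule prob_space_distr) measurable
  interpret Q: prob_space Q unfolding Q_def by (rule prob_space_distr) measurable
  interpret R: prob_space R unfolding R_def by (rule prob_space_distr) measurable
  have [measurable_cong, simp]: "sets P = sets S" "sets Q = sets T" "sets R = sets U"
    by (simp_all add: P_def Q_def R_def)
  have rect: "emeasure M (X -` A \<inter> Y -` B \<inter> Z -` C \<inter> space M) = emeasure P A * emeasure Q B * emeasure R C"
    if "A \<in> sets S" "B \<in> sets T" "C \<in> sets U" for A B C
    using that indep[OF that]
    by (simp add: P_def Q_def R_def emeasure_distr emeasure_eq_measure ennreal_mult'[symmetric] mult.assoc)
  interpret QR: pair_prob_space Q R ..
  \<comment> \<open>Uniqueness of the outer product asks for sets \<open>A \<times> D\<close> with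
    \<open>D\<close> any measurable set of pairs, whereas independence speaks only of
    \<open>B \<times> C\<close>. A second uniqueness argument with \<open>A\<close> fixed closes
    this gap.\<close>
  have joint: "P \<Otimes>\<^sub>M (Q \<Otimes>\<^sub>M R) = distr M (S \<Otimes>\<^sub>M (T \<Otimes>\<^sub>M U)) (\<lambda>\<omega>. (X \<omega>, Y \<omega>, Z \<omega>))"
  proof (rule pair_measure_eqI)
    fix A D assume "A \<in> sets P" and D: "D \<in> sets (Q \<Otimes>\<^sub>M R)"
    then have A[measurable]: "A \<in> sets S" by simp
    have D'[measurable]: "D \<in> sets (T \<Otimes>\<^sub>M U)" using D by (simp cong: sets_pair_measure_cong)
    let ?XA = "X -` A \<inter> space M"
    have XA[measurable]: "?XA \<in> sets M" by measurable
    let ?c = "emeasure P A"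
    have c: "?c < \<infinity>" by (simp add: P.emeasure_eq_measure)
    \<comment> \<open>The law of \<open>(Y, Z)\<close> restricted to the event that \<open>X\<close>
      lies in \<open>A\<close>, a measure of total mass \<open>?c\<close>.\<close>
    let ?N = "distr (density M (indicator ?XA)) (T \<Otimes>\<^sub>M U) (\<lambda>\<omega>. (Y \<omega>, Z \<omega>))"
    have N: "emeasure ?N E = emeasure M (?XA \<inter> ((\<lambda>\<omega>. (Y \<omega>, Z \<omega>)) -` E \<inter> space M))"
      if [measurable]: "E \<in> sets (T \<Otimes>\<^sub>M U)" for E
    proof -
      have "emeasure ?N E = emeasure (density M (indicator ?XA)) ((\<lambda>\<omega>. (Y \<omega>, Z \<omega>)) -` E \<inter> space M)"
        by (subst emeasure_distr) auto
      also have "\<dots> = (\<integral>\<^sup>+\<omega>. indicator ?XA \<omega> * indicator ((\<lambda>\<omega>. (Y \<omega>, Z \<omega>)) -` E \<inter> space M) \<omega> \<partial>M)"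
        by (rule emeasure_density) measurable
      also have "\<dots> = (\<integral>\<^sup>+\<omega>. indicator (?XA \<inter> ((\<lambda>\<omega>. (Y \<omega>, Z \<omega>)) -` E \<inter> space M)) \<omega> \<partial>M)"
        by (simp only: indicator_inter_arith)
      also have "\<dots> = emeasure M (?XA \<inter> ((\<lambda>\<omega>. (Y \<omega>, Z \<omega>)) -` E \<inter> space M))"
        by (rule nn_integral_indicator) measurable
      finally show ?thesis .
    qed
    \<comment> \<open>Scaling \<open>Q\<close> by the constant \<open>?c\<close> absorbs the
      probability of the fixed event, so both measures agree on rectangles.\<close>
    have scaled: "density Q (\<lambda>_. ?c) \<Otimes>\<^sub>M R = distr (density M (indicator ?XA)) (T \<Otimes>\<^sub>M U) (\<lambda>\<omega>. (Y \<omega>, Z \<omega>))"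
    proof (rule pair_measure_eqI)
      show "sigma_finite_measure (density Q (\<lambda>_. ?c))"
      proof (intro finite_measure.axioms finite_measureI)
        have "emeasure (density Q (\<lambda>_. ?c)) (space Q) = ?c * emeasure Q (space Q)"
          by (subst emeasure_density) (simp_all add: nn_integral_cmult sets.top[of Q, simplified])
        then show "emeasure (density Q (\<lambda>_. ?c)) (space (density Q (\<lambda>_. ?c))) \<noteq> \<infinity>"
          using c by (simp add: Q.emeasure_space_1)
      qed
      show "sigma_finite_measure R" ..
      show "sets (density Q (\<lambda>_. ?c) \<Otimes>\<^sub>M R) = sets (distr (density M (indicator ?XA)) (T \<Otimes>\<^sub>M U) (\<lambda>\<omega>. (Y \<omega>, Z \<omega>)))"
        by (simp cong: sets_pair_measure_cong)
      fix B C assume "B \<in> sets (density Q (\<lambda>_. ?c))" "C \<in> sets R"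
      then have [measurable]: "B \<in> sets T" "C \<in> sets U" by simp_all
      have "emeasure (distr (density M (indicator ?XA)) (T \<Otimes>\<^sub>M U) (\<lambda>\<omega>. (Y \<omega>, Z \<omega>))) (B \<times> C)
        = emeasure M (?XA \<inter> ((\<lambda>\<omega>. (Y \<omega>, Z \<omega>)) -` (B \<times> C) \<inter> space M))"
        by (rule N) measurable
      also have "?XA \<inter> ((\<lambda>\<omega>. (Y \<omega>, Z \<omega>)) -` (B \<times> C) \<inter> space M) = X -` A \<inter> Y -` B \<inter> Z -` C \<inter> space M"
        by auto
      also have "emeasure M \<dots> = ?c * emeasure Q B * emeasure R C" by (rule rect) fact+
      also have "?c * emeasure Q B = emeasure (density Q (\<lambda>_. ?c)) B"
        by (simp add: emeasure_density nn_integral_cmult)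
      finally show "emeasure (density Q (\<lambda>_. ?c)) B * emeasure R C
        = emeasure (distr (density M (indicator ?XA)) (T \<Otimes>\<^sub>M U) (\<lambda>\<omega>. (Y \<omega>, Z \<omega>))) (B \<times> C)" ..
    qed
    have "emeasure P A * emeasure (Q \<Otimes>\<^sub>M R) D = emeasure (density Q (\<lambda>_. ?c) \<Otimes>\<^sub>M R) D"
      by (simp add: R.emeasure_pair_measure_alt nn_integral_density nn_integral_cmult R.measurable_emeasure_Pair)
    also have "\<dots> = emeasure M (?XA \<inter> ((\<lambda>\<omega>. (Y \<omega>, Z \<omega>)) -` D \<inter> space M))"
      unfolding scaled
      by (rule N) measurable
    also have "?XA \<inter> ((\<lambda>\<omega>. (Y \<omega>, Z \<omega>)) -` D \<inter> space M) = (\<lambda>\<omega>. (X \<omega>, Y \<omega>, Z \<omega>)) -` (A \<times> D) \<inter> space M"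
      by auto
    also have "emeasure M \<dots> = emeasure (distr M (S \<Otimes>\<^sub>M (T \<Otimes>\<^sub>M U)) (\<lambda>\<omega>. (X \<omega>, Y \<omega>, Z \<omega>))) (A \<times> D)"
      by (subst emeasure_distr) auto
    finally show "emeasure P A * emeasure (Q \<Otimes>\<^sub>M R) D
      = emeasure (distr M (S \<Otimes>\<^sub>M (T \<Otimes>\<^sub>M U)) (\<lambda>\<omega>. (X \<omega>, Y \<omega>, Z \<omega>))) (A \<times> D)" .
  qed (simp_all add: P.sigma_finite_measure_axioms QR.sigma_finite_measure_axioms cong: sets_pair_measure_cong)
  have "(\<integral>\<^sup>+\<omega>. H (X \<omega>, Y \<omega>, Z \<omega>) \<partial>M) = (\<integral>\<^sup>+p. H p \<partial>(P \<Otimes>\<^sub>M (Q \<Otimes>\<^sub>M R)))"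
    unfolding joint by (subst nn_integral_distr) auto
  also have "\<dots> = (\<integral>\<^sup>+x. \<integral>\<^sup>+y. \<integral>\<^sup>+z. H (x, y, z) \<partial>R \<partial>Q \<partial>P)"
  proof -
    have HP: "H \<in> borel_measurable (P \<Otimes>\<^sub>M (Q \<Otimes>\<^sub>M R))"
      using H by (simp cong: measurable_cong_sets sets_pair_measure_cong)
    have "(\<integral>\<^sup>+p. H p \<partial>(P \<Otimes>\<^sub>M (Q \<Otimes>\<^sub>M R))) = (\<integral>\<^sup>+x. \<integral>\<^sup>+p. H (x, p) \<partial>(Q \<Otimes>\<^sub>M R) \<partial>P)"
      by (rule QR.nn_integral_fst[symmetric]) (rule HP)
    also have "\<dots> = (\<integral>\<^sup>+x. \<integral>\<^sup>+y. \<integral>\<^sup>+z. H (x, y, z) \<partial>R \<partial>Q \<partial>P)"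
      by (rule nn_integral_cong, rule R.nn_integral_fst[symmetric])
         (rule measurable_compose_Pair1[OF _ HP])
    finally show ?thesis .
  qed
  also have "\<dots> = (\<integral>\<^sup>+x. f x * (\<integral>\<^sup>+y. g y * (\<integral>\<^sup>+z. h z * H (x, y, z) \<partial>U) \<partial>T) \<partial>S)"
  proof -
    have R: "R = density U h" and Q: "Q = density T g" and P: "P = density S f"
      unfolding P_def Q_def R_def using X Y Z by (simp_all add: distributed_distr_eq_density)
    have "(\<integral>\<^sup>+z. H (x, y, z) \<partial>R) = (\<integral>\<^sup>+z. h z * H (x, y, z) \<partial>U)"
      if [measurable]: "x \<in> space S" "y \<in> space T" for x y
      unfolding R by (rule nn_integral_density) measurable
    then have "(\<integral>\<^sup>+y. \<integral>\<^sup>+z. H (x, y, z) \<partial>R \<partial>Q) = (\<integral>\<^sup>+y. \<integral>\<^sup>+z. h z * H (x, y, z) \<partial>U \<partial>Q)"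
      if "x \<in> space S" for x
      using that by (intro nn_integral_cong) (simp add: Q)
    also have "(\<integral>\<^sup>+y. \<integral>\<^sup>+z. h z * H (x, y, z) \<partial>U \<partial>Q) = (\<integral>\<^sup>+y. g y * (\<integral>\<^sup>+z. h z * H (x, y, z) \<partial>U) \<partial>T)"
      if [measurable]: "x \<in> space S" for x
      unfolding Q by (rule nn_integral_density) measurable
    finally have "(\<integral>\<^sup>+x. \<integral>\<^sup>+y. \<integral>\<^sup>+z. H (x, y, z) \<partial>R \<partial>Q \<partial>P)
      = (\<integral>\<^sup>+x. (\<integral>\<^sup>+y. g y * (\<integral>\<^sup>+z. h z * H (x, y, z) \<partial>U) \<partial>T) \<partial>P)"
      by (intro nn_integral_cong) (simp add: P)
    also have "\<dots> = (\<integral>\<^sup>+x. f x * (\<integral>\<^sup>+y. g y * (\<integral>\<^sup>+z. h z * H (x, y, z) \<partial>U) \<partial>T) \<partial>S)"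
      unfolding P by (rule nn_integral_density) measurable
    finally show ?thesis .
  qed
  finally show ?thesis .
qed

section \<open>The completed square\<close>

declare transpose_matrix_vector [simp del]

lemma matrix_add_rdistrib: "(B + C) ** A = B ** A + C ** A"
  and matrix_sub_rdistrib: "(B - C) ** A = B ** A - C ** A"
  and matrix_sub_ldistrib: "A' ** (B - C) = A' ** B - A' ** C"
  for B C :: "real^'n^'m" and A :: "real^'k^'n" and A' :: "real^'m^'k"
  by (simp_all add: matrix_matrix_mult_def vec_eq_iff sum.distrib sum_subtractf algebra_simps)

text \<open>\<open>matrix_inv\<close> is a choice, so every computed inverse goes through this
  lemma; for square matrices a one-sided inverse is enough.\<close>

lemma matrix_inv_unique:
  fixes A B :: "real^'n^'n"
  assumes "A ** B = mat 1"
  shows "matrix_inv A = B"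
proof -
  have BA: "B ** A = mat 1" using assms by (rule matrix_left_right_inverse[THEN iffD1])
  have "A ** matrix_inv A = mat 1 \<and> matrix_inv A ** A = mat 1"
    unfolding matrix_inv_def by (rule someI[of _ B]) (simp add: assms BA)
  then have "B = B ** (A ** matrix_inv A)" by simp
  also have "\<dots> = matrix_inv A" by (simp add: matrix_mul_assoc BA)
  finally show ?thesis by simp
qed

lemma matrix_inv_inverse:
  fixes A :: "real^'n^'n"
  assumes "det A \<noteq> 0"
  shows "A ** matrix_inv A = mat 1" and "matrix_inv A ** A = mat 1"
proof -
  obtain B where "A ** B = mat 1" using assms by (auto simp: invertible_det_nz[symmetric] invertible_def)
  with matrix_inv_unique[OF this] show "A ** matrix_inv A = mat 1" by simp
  then show "matrix_inv A ** A = mat 1" by (rule matrix_left_right_inverse[THEN iffD1])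
qed

lemma inner_matrix_vector_transpose:
  fixes A :: "real^'n^'m"
  shows "x \<bullet> (A *v y) = (transpose A *v x) \<bullet> y"
  by (simp add: dot_lmul_matrix transpose_matrix_vector)

lemma pos_def_mat_add_gram:
  fixes L :: "real^'q^'p"
  assumes "pos_def_mat \<Sigma>"
  shows "pos_def_mat (\<Sigma> + L ** transpose L)"
  using assms
proof (rule pos_def_mat_add)
  show "transpose (L ** transpose L) = L ** transpose L"
    by (simp add: matrix_transpose_mul)
  show "x \<bullet> ((L ** transpose L) *v x) \<ge> 0" for x
    by (simp add: matrix_vector_mul_assoc[symmetric] inner_matrix_vector_transpose[of x L])
qed

locale skew_scale =
  fixes \<Sigma> S :: "real^'p^'p" and L :: "real^'q^'p"
  assumes pd: "pos_def_mat \<Sigma>" and root: "S ** transpose S = \<Sigma>"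
begin

definition "\<Omega> = \<Sigma> + L ** transpose L"
definition "\<Delta> = mat 1 - transpose L ** matrix_inv \<Omega> ** L"
definition "W = matrix_inv \<Sigma>"
text \<open>The matrix of the terms quadratic in \<open>w\<close> in the exponent; it proves to be
  the inverse of \<open>\<Delta>\<close>.\<close>

definition "P = mat 1 + transpose L ** W ** L"

lemma det_S: "det \<Sigma> = (det S)\<^sup>2" "det S \<noteq> 0"
proof -
  show *: "det \<Sigma> = (det S)\<^sup>2" by (simp add: root[symmetric] det_mul power2_eq_square)
  show "det S \<noteq> 0" using pos_def_mat_det_pos[OF pd] * by auto
qed

lemma S_inv: "matrix_inv S ** S = mat 1" "S ** matrix_inv S = mat 1"
  using det_S(2) by (simp_all add: matrix_inv_inverse)

lemma W_eq: "W = transpose (matrix_inv S) ** matrix_inv S"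
  unfolding W_def
proof (rule matrix_inv_unique)
  have "\<Sigma> ** (transpose (matrix_inv S) ** matrix_inv S) = S ** transpose (matrix_inv S ** S) ** matrix_inv S"
    by (simp add: root[symmetric] matrix_transpose_mul matrix_mul_assoc)
  then show "\<Sigma> ** (transpose (matrix_inv S) ** matrix_inv S) = mat 1" by (simp add: S_inv)
qed

lemma W_inv: "\<Sigma> ** W = mat 1" "W ** \<Sigma> = mat 1"
  unfolding W_def using pos_def_mat_det_nz[OF pd] by (simp_all add: matrix_inv_inverse)

lemma transpose_W: "transpose W = W"
  unfolding W_eq by (simp add: matrix_transpose_mul)

lemma inner_W: "v \<bullet> (W *v v) = (matrix_inv S *v v) \<bullet> (matrix_inv S *v v)"
  unfolding W_eq by (simp add: matrix_vector_mul_assoc[symmetric] inner_matrix_vector_transpose[of v])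

lemma pos_def_\<Omega>: "pos_def_mat \<Omega>"
  unfolding \<Omega>_def using pd by (rule pos_def_mat_add_gram)

lemma \<Omega>_inv: "\<Omega> ** matrix_inv \<Omega> = mat 1" "matrix_inv \<Omega> ** \<Omega> = mat 1"
  using pos_def_mat_det_nz[OF pos_def_\<Omega>] by (simp_all add: matrix_inv_inverse)

lemma pos_def_P: "pos_def_mat P"
  unfolding P_def
proof (rule pos_def_mat_add[OF pos_def_mat_1])
  show "transpose (transpose L ** W ** L) = transpose L ** W ** L"
    by (simp add: matrix_transpose_mul transpose_W matrix_mul_assoc)
  show "x \<bullet> ((transpose L ** W ** L) *v x) \<ge> 0" for x
    by (simp add: matrix_vector_mul_assoc[symmetric] inner_matrix_vector_transpose[of x "transpose L"] inner_W)
qed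

text \<open>This is the Woodbury identity. In the product of the two correction terms the inner
  factor \<open>L ** transpose L\<close> equals \<open>\<Omega> - \<Sigma>\<close>; each part
  cancels against a neighbouring inverse, and the remainder telescopes.\<close>

lemma P_\<Delta>: "P ** \<Delta> = mat 1"
proof -
  let ?O = "matrix_inv \<Omega>" and ?T = "transpose L"
  have 1: "\<Omega> - \<Sigma> = L ** ?T" by (simp add: \<Omega>_def)
  have "(?T ** W ** L) ** (?T ** ?O ** L) = ?T ** W ** (\<Omega> - \<Sigma>) ** ?O ** L"
    unfolding 1 by (simp only: matrix_mul_assoc)
  also have "\<dots> = ?T ** W ** (\<Omega> ** ?O) ** L - ?T ** (W ** \<Sigma>) ** ?O ** L"
    by (simp only: matrix_sub_ldistrib matrix_sub_rdistrib matrix_mul_assoc)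
  also have "\<dots> = ?T ** W ** L - ?T ** ?O ** L"
    by (simp add: \<Omega>_inv W_inv)
  finally have 2: "(?T ** W ** L) ** (?T ** ?O ** L) = ?T ** W ** L - ?T ** ?O ** L" .
  have "P ** \<Delta> = mat 1 - ?T ** ?O ** L + (?T ** W ** L - (?T ** W ** L) ** (?T ** ?O ** L))"
    unfolding P_def \<Delta>_def
    by (simp only: matrix_add_rdistrib matrix_sub_ldistrib matrix_mul_lid matrix_mul_rid) (simp add: algebra_simps)
  then show ?thesis unfolding 2 by simp
qed

lemma inv_\<Delta>: "matrix_inv \<Delta> = P"
  by (rule matrix_inv_unique, rule matrix_left_right_inverse[THEN iffD1], rule P_\<Delta>)

text \<open>\<open>\<Omega> ** W\<close> and \<open>P\<close> are \<open>mat 1 + U ** V\<close> and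
  \<open>mat 1 + V ** U\<close> for \<open>U = L\<close> and \<open>V = transpose L ** W\<close>, so
  their determinants agree up to sign, and all of them are positive. Since \<open>W\<close> inverts
  \<open>\<Sigma>\<close> and \<open>P\<close> inverts \<open>\<Delta>\<close>, the claim
  follows.\<close>

lemma det_identity: "det \<Omega> * det \<Delta> = (det S)\<^sup>2"
proof -
  have \<Omega>W: "\<Omega> ** W = mat 1 + L ** (transpose L ** W)"
    by (simp add: \<Omega>_def matrix_add_rdistrib W_inv matrix_mul_assoc)
  have P: "P = mat 1 + (transpose L ** W) ** L" by (simp add: P_def)
  have detW: "det \<Sigma> * det W = 1" by (metis W_inv(1) det_I det_mul)
  have det\<Delta>: "det P * det \<Delta> = 1" by (metis P_\<Delta> det_I det_mul)
  have pos: "det \<Omega> > 0" "det P > 0" "det \<Sigma> > 0"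
    using pos_def_mat_det_pos pos_def_\<Omega> pos_def_P pd by auto
  then have "det W > 0" using detW by (metis zero_less_mult_pos zero_less_one)
  have "\<bar>det (\<Omega> ** W)\<bar> = \<bar>det P\<bar>"
    unfolding \<Omega>W P
  proof (rule abs_det_sylvester)
    show "det (mat 1 + L ** (transpose L ** W)) \<noteq> 0"
      using pos \<open>det W > 0\<close> unfolding \<Omega>W[symmetric] det_mul by simp
    show "det (mat 1 + (transpose L ** W) ** L) \<noteq> 0" using pos unfolding P by simp
  qed
  then have "det \<Omega> * det W = det P" using pos \<open>det W > 0\<close> by (simp add: det_mul abs_mult)
  then have "det \<Omega> * det \<Delta> * (det \<Sigma> * det W) = det \<Sigma> * (det P * det \<Delta>)" by (simp add: ac_simps)
  then show ?thesis by (simp only: detW det\<Delta> mult_1_right) (simp only: det_S)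
qed

text \<open>Both sides are quadratic in \<open>w\<close> with leading matrix \<open>P\<close>. The
  linear terms match because \<open>m\<close> solves the normal equation
  \<open>P *v m = transpose L *v (W *v x)\<close>, and the constants match by
  \<open>xb\<close>.\<close>

lemma quadratic_form_split:
  fixes x :: "real^'p" and w :: "real^'q"
  defines "m \<equiv> transpose L *v (matrix_inv \<Omega> *v x)"
  shows "w \<bullet> w + (matrix_inv S *v (x - L *v w)) \<bullet> (matrix_inv S *v (x - L *v w))
    = x \<bullet> (matrix_inv \<Omega> *v x) + (w - m) \<bullet> (matrix_inv \<Delta> *v (w - m))"
proof -
  define a where "a = matrix_inv \<Omega> *v x"
  define b where "b = W *v x"
  have \<Omega>a: "\<Sigma> *v a + L *v m = x"
  proof -
    have "\<Omega> *v a = x" unfolding a_def by (simp add: matrix_vector_mul_assoc \<Omega>_inv)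
    then show ?thesis by (simp add: \<Omega>_def[THEN arg_cong[where f = "\<lambda>A. A *v a"]] m_def a_def[symmetric]
      matrix_vector_mult_add_rdistrib matrix_vector_mul_assoc)
  qed
  \<comment> \<open>Applying \<open>W\<close> to \<open>\<Omega> *v a = x\<close>, split along
    \<open>\<Omega> = \<Sigma> + L ** transpose L\<close>.\<close>
  have Lm: "W *v (L *v m) = b - a"
  proof -
    have "W *v (\<Sigma> *v a) = a" by (simp add: matrix_vector_mul_assoc W_inv)
    then show ?thesis using \<Omega>a unfolding b_def by (metis add_diff_cancel_left' matrix_vector_right_distrib)
  qed
  have Wsym: "u \<bullet> (W *v v) = v \<bullet> (W *v u)" for u v
    by (metis inner_matrix_vector_transpose transpose_W inner_commute)
  have P: "P *v u = u + transpose L *v (W *v (L *v u))" for u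
    by (simp add: P_def matrix_vector_mult_add_rdistrib matrix_vector_mul_assoc matrix_mul_assoc)
  have Pm: "P *v m = transpose L *v b"
    unfolding P Lm by (simp add: matrix_vector_mult_diff_distrib m_def a_def)
  have LT: "u \<bullet> (transpose L *v v) = (L *v u) \<bullet> v" for u v
    by (simp add: inner_matrix_vector_transpose)
  have Psym: "m \<bullet> (P *v w) = w \<bullet> (P *v m)"
    unfolding P by (simp add: inner_add_right LT inner_commute Wsym[of "L *v m" "L *v w"])
  have xb: "(L *v m) \<bullet> b = x \<bullet> b - x \<bullet> a"
  proof -
    have "(L *v m) \<bullet> b = x \<bullet> (W *v (L *v m))" unfolding b_def by (rule Wsym)
    then show ?thesis unfolding Lm by (simp add: inner_diff_right)
  qed
  have "(w - m) \<bullet> (P *v (w - m)) = w \<bullet> (P *v w) - 2 * (w \<bullet> (P *v m)) + m \<bullet> (P *v m)"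
    using Psym by (simp add: matrix_vector_mult_diff_distrib inner_diff_left inner_diff_right)
  also have "\<dots> = w \<bullet> w + (L *v w) \<bullet> (W *v (L *v w)) - 2 * ((L *v w) \<bullet> b) + (x \<bullet> b - x \<bullet> a)"
    unfolding Pm by (simp add: P inner_add_right LT xb)
  finally have R: "(w - m) \<bullet> (P *v (w - m)) = w \<bullet> w + (L *v w) \<bullet> (W *v (L *v w)) - 2 * ((L *v w) \<bullet> b) + (x \<bullet> b - x \<bullet> a)" .
  have "(x - L *v w) \<bullet> (W *v (x - L *v w)) = x \<bullet> b - 2 * ((L *v w) \<bullet> b) + (L *v w) \<bullet> (W *v (L *v w))"
    using Wsym[of x "L *v w"] by (simp add: matrix_vector_mult_diff_distrib inner_diff_left inner_diff_right b_def)
  with R show ?thesis unfolding inv_\<Delta> inner_W[symmetric] a_def[symmetric] by simp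
qed

end

section \<open>Integrating out the normal vectors\<close>

lemma std_mvn_density_eq:
  fixes x :: "real^'n"
  shows "std_mvn_density x = (2 * pi) powr (- real CARD('n) / 2) * exp (- (x \<bullet> x) / 2)"
proof -
  have "(1 / sqrt (2 * pi)) ^ CARD('n) = (2 * pi) powr (- real CARD('n) / 2)"
    by (simp add: powr_half_sqrt[symmetric] powr_minus_divide powr_powr powr_realpow[symmetric] power_one_over)
  moreover have "(\<Prod>i\<in>UNIV. exp (- (x $ i)\<^sup>2 / 2)) = exp (- (x \<bullet> x) / 2)"
    by (simp add: exp_sum[symmetric] inner_vec_def sum_negf sum_divide_distrib power2_eq_square)
  ultimately show ?thesis
    unfolding std_mvn_density_def std_normal_density_def prod.distrib prod_constant by simp
qed

lemma std_mvn_density_nonneg: "std_mvn_density x \<ge> 0"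
  by (simp add: std_mvn_density_eq)

lemma borel_measurable_std_mvn_density [measurable]: "std_mvn_density \<in> borel_measurable borel"
  unfolding std_mvn_density_def by measurable

text \<open>Evenness lets the whole integrand, density included, depend on \<open>z\<close> through
  its absolute values only, as folding requires.\<close>

lemma std_mvn_density_abs: "std_mvn_density (\<chi> i. \<bar>z $ i\<bar>) = std_mvn_density z"
  by (simp add: std_mvn_density_def std_normal_density_def)

lemma ennreal_mult4:
  assumes "a \<ge> 0" "b \<ge> 0" "c \<ge> 0"
  shows "ennreal (a * (b * (c * d))) = ennreal a * (ennreal b * (ennreal c * ennreal d))"
  using assms by (simp add: ennreal_mult')

context skew_scale
begin

definition "mloc x = transpose L *v (matrix_inv \<Omega> *v x)"
definition "maha x = x \<bullet> (matrix_inv \<Omega> *v x)"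
definition "resid x w = (w - mloc x) \<bullet> (matrix_inv \<Delta> *v (w - mloc x))"
text \<open>The constant of a normal density in \<open>p + q\<close> dimensions whose covariance has
  determinant \<open>(det S)\<close> squared.\<close>

definition "norm_const = (2 * pi) powr (- (real CARD('p) + real CARD('q)) / 2) / \<bar>det S\<bar>"
text \<open>For \<open>w\<close> in the orthant, the joint density of \<open>Y - \<mu>\<close> and
  \<open>\<bar>Z0\<bar> / sqrt g\<close> at \<open>(x, w)\<close> given
  \<open>G = g\<close>.\<close>

definition "kern g x w = 2 ^ CARD('q) * norm_const * g powr ((real CARD('p) + real CARD('q)) / 2)
   * exp (- (g / 2) * (maha x + resid x w))"

lemma maha_nonneg: "maha x \<ge> 0"
proof -
  define a where "a = matrix_inv \<Omega> *v x"
  have "x = \<Omega> *v a" by (simp add: a_def matrix_vector_mul_assoc \<Omega>_inv)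
  then have "maha x = a \<bullet> (\<Omega> *v a)" unfolding maha_def a_def[symmetric] by (simp add: inner_commute)
  then show ?thesis using pos_def_\<Omega> by (cases "a = 0") (auto simp: pos_def_mat_def less_imp_le)
qed

lemma resid_nonneg: "resid x w \<ge> 0"
  using pos_def_P unfolding resid_def inv_\<Delta> by (cases "w = mloc x") (auto simp: pos_def_mat_def less_imp_le)

lemma norm_const_nonneg: "norm_const \<ge> 0" by (simp add: norm_const_def)

lemma measurable_mloc [measurable (raw)]:
  assumes [measurable]: "f \<in> borel_measurable N"
  shows "(\<lambda>z. mloc (f z)) \<in> borel_measurable N"
  unfolding mloc_def by measurable

lemma measurable_maha [measurable (raw)]:
  assumes [measurable]: "f \<in> borel_measurable N"
  shows "(\<lambda>z. maha (f z)) \<in> borel_measurable N"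
  unfolding maha_def by measurable

lemma measurable_resid [measurable (raw)]:
  assumes [measurable]: "f \<in> borel_measurable N" "h \<in> borel_measurable N"
  shows "(\<lambda>z. resid (f z) (h z)) \<in> borel_measurable N"
  unfolding resid_def by measurable

lemma measurable_kern [measurable (raw)]:
  assumes [measurable]: "f \<in> borel_measurable N" "h \<in> borel_measurable N" "k \<in> borel_measurable N"
  shows "(\<lambda>z. kern (k z) (f z) (h z)) \<in> borel_measurable N"
  unfolding kern_def by measurable

lemma kern_eq:
  assumes g: "g > 0"
  shows "2 ^ CARD('q) * sqrt g ^ CARD('q) * (std_mvn_density (sqrt g *\<^sub>R w)
     * (sqrt g ^ CARD('p) / \<bar>det S\<bar> * std_mvn_density (matrix_inv S *v (sqrt g *\<^sub>R x - L *v (sqrt g *\<^sub>R w))))) = kern g x w"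
proof -
  let ?T = "matrix_inv S"
  have arg: "?T *v (sqrt g *\<^sub>R x - L *v (sqrt g *\<^sub>R w)) = sqrt g *\<^sub>R (?T *v (x - L *v w))"
    by (simp add: matrix_vector_mult_diff_distrib scaleR_diff_right matrix_vector_mult_scaleR)
  have ex: "exp (- (sqrt g *\<^sub>R w \<bullet> sqrt g *\<^sub>R w) / 2) * exp (- (sqrt g *\<^sub>R (?T *v (x - L *v w)) \<bullet> sqrt g *\<^sub>R (?T *v (x - L *v w))) / 2)
      = exp (- (g / 2) * (w \<bullet> w + (?T *v (x - L *v w)) \<bullet> (?T *v (x - L *v w))))"
  proof -
    have 1: "sqrt g *\<^sub>R v \<bullet> sqrt g *\<^sub>R v = g * (v \<bullet> v)" for v :: "real^'q"
      using g by (simp add: mult.assoc[symmetric])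
    have 2: "sqrt g *\<^sub>R v \<bullet> sqrt g *\<^sub>R v = g * (v \<bullet> v)" for v :: "real^'p"
      using g by (simp add: mult.assoc[symmetric])
    show ?thesis
      unfolding 1 2 exp_add[symmetric] by (simp add: distrib_left add_divide_distrib)
  qed
  have qf: "w \<bullet> w + (?T *v (x - L *v w)) \<bullet> (?T *v (x - L *v w)) = maha x + resid x w"
    unfolding maha_def resid_def mloc_def by (rule quadratic_form_split)
  have pw: "sqrt g ^ CARD('q) * sqrt g ^ CARD('p) = g powr ((real CARD('p) + real CARD('q)) / 2)"
    using g by (simp add: powr_half_sqrt[symmetric] powr_powr powr_realpow[symmetric] powr_add[symmetric] add_divide_distrib add.commute)
  have nc: "(2 * pi) powr (- real CARD('q) / 2) * (2 * pi) powr (- real CARD('p) / 2) / \<bar>det S\<bar> = norm_const"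
    unfolding norm_const_def powr_add[symmetric] by (simp add: field_simps)
  have "2 ^ CARD('q) * sqrt g ^ CARD('q) * (std_mvn_density (sqrt g *\<^sub>R w)
     * (sqrt g ^ CARD('p) / \<bar>det S\<bar> * std_mvn_density (sqrt g *\<^sub>R (?T *v (x - L *v w)))))
    = 2 ^ CARD('q) * ((2 * pi) powr (- real CARD('q) / 2) * (2 * pi) powr (- real CARD('p) / 2) / \<bar>det S\<bar>)
     * (sqrt g ^ CARD('q) * sqrt g ^ CARD('p))
     * (exp (- (sqrt g *\<^sub>R w \<bullet> sqrt g *\<^sub>R w) / 2) * exp (- (sqrt g *\<^sub>R (?T *v (x - L *v w)) \<bullet> sqrt g *\<^sub>R (?T *v (x - L *v w))) / 2))"
    unfolding std_mvn_density_eq by (simp only: times_divide_eq_left times_divide_eq_right ac_simps)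
  then show ?thesis
    unfolding arg ex qf pw nc kern_def .
qed

text \<open>For fixed \<open>u\<close> the variable \<open>z1\<close> is exchanged for the value
  \<open>y\<close> of \<open>Y\<close>; then \<open>z0\<close> is folded onto the orthant and
  rescaled by \<open>sqrt g\<close>. The Jacobians and the two normal densities assemble into
  \<open>kern\<close>.\<close>

lemma nn_integral_given_scale:
  assumes [measurable]: "k \<in> borel_measurable borel" and g: "g > 0"
  shows "(\<integral>\<^sup>+z0. ennreal (std_mvn_density z0) * (\<integral>\<^sup>+z1. ennreal (std_mvn_density z1) *
        k (\<mu> + (1 / sqrt g) *\<^sub>R (L *v (\<chi> i. \<bar>z0 $ i\<bar>) + S *v z1)) \<partial>lborel) \<partial>lborel)
    = (\<integral>\<^sup>+y. k y * (\<integral>\<^sup>+w. indicator {w. \<forall>i. 0 \<le> w $ i} w * ennreal (kern g (y - \<mu>) w) \<partial>lborel) \<partial>lborel)"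
    (is "?lhs = _")
proof -
  let ?T = "matrix_inv S"
  let ?f = "\<lambda>x. ennreal (std_mvn_density x)"
  let ?a = "\<lambda>u y. ?T *v (sqrt g *\<^sub>R (y - \<mu>) - L *v u)"
  let ?C = "ennreal (sqrt g ^ CARD('p) / \<bar>det S\<bar>)"
  have inner: "(\<integral>\<^sup>+z. ?f z * k (\<mu> + (1 / sqrt g) *\<^sub>R (L *v u + S *v z)) \<partial>lborel)
      = ?C * (\<integral>\<^sup>+y. ?f (?a u y) * k y \<partial>lborel)" for u
  proof -
    let ?h = "\<lambda>y. ?f (?a u y) * k y" and ?t = "\<mu> + (1 / sqrt g) *\<^sub>R (L *v u)"
    have arg: "?a u (?t + (1 / sqrt g) *\<^sub>R (S *v z)) = z" for z
    proof -
      have "sqrt g *\<^sub>R (?t + (1 / sqrt g) *\<^sub>R (S *v z) - \<mu>) - L *v u = S *v z"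
        using g by (simp add: scaleR_add_right)
      then show ?thesis by (simp add: matrix_vector_mul_assoc S_inv)
    qed
    have "(\<integral>\<^sup>+y. ?h y \<partial>lborel) = ennreal (\<bar>1 / sqrt g\<bar> ^ CARD('p)) * (\<integral>\<^sup>+x. ?h (?t + (1 / sqrt g) *\<^sub>R x) \<partial>lborel)"
      using g nn_integral_lborel_affine[of ?h "1 / sqrt g" ?t] by simp
    also have "(\<integral>\<^sup>+x. ?h (?t + (1 / sqrt g) *\<^sub>R x) \<partial>lborel)
        = ennreal \<bar>det S\<bar> * (\<integral>\<^sup>+z. ?h (?t + (1 / sqrt g) *\<^sub>R (S *v z)) \<partial>lborel)"
      by (rule nn_integral_lborel_linear[OF _ det_S(2)]) measurable
    also have "(\<integral>\<^sup>+z. ?h (?t + (1 / sqrt g) *\<^sub>R (S *v z)) \<partial>lborel)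
        = (\<integral>\<^sup>+z. ?f z * k (\<mu> + (1 / sqrt g) *\<^sub>R (L *v u + S *v z)) \<partial>lborel)"
      unfolding arg by (simp add: scaleR_add_right add.assoc)
    finally have "?C * (\<integral>\<^sup>+y. ?h y \<partial>lborel) = (?C * (ennreal (\<bar>1 / sqrt g\<bar> ^ CARD('p)) * ennreal \<bar>det S\<bar>))
       * (\<integral>\<^sup>+z. ?f z * k (\<mu> + (1 / sqrt g) *\<^sub>R (L *v u + S *v z)) \<partial>lborel)"
      by (simp only: mult.assoc)
    also have "?C * (ennreal (\<bar>1 / sqrt g\<bar> ^ CARD('p)) * ennreal \<bar>det S\<bar>) = 1"
      \<comment> \<open>\<open>?C\<close> is the reciprocal of the two Jacobians, of the scaling by
        \<open>1 / sqrt g\<close> and of \<open>S\<close>.\<close>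
      using g det_S(2) by (simp add: ennreal_mult'[symmetric] power_one_over)
    finally show ?thesis by simp
  qed
  let ?G = "\<lambda>u. ?f u * (?C * (\<integral>\<^sup>+y. ?f (?a u y) * k y \<partial>lborel))"
  let ?I = "indicator {w::real^'q. \<forall>i. 0 \<le> w $ i} :: _ \<Rightarrow> ennreal"
  have [measurable]: "(\<lambda>u. \<integral>\<^sup>+y. ?f (?a u y) * k y \<partial>lborel) \<in> borel_measurable borel"
    by measurable
  have "?lhs = (\<integral>\<^sup>+z0. ?G (\<chi> i. \<bar>z0 $ i\<bar>) \<partial>lborel)"
    by (simp only: inner std_mvn_density_abs)
  also have "\<dots> = 2 ^ CARD('q) * (\<integral>\<^sup>+u. ?G u * ?I u \<partial>lborel)"
    by (rule nn_integral_lborel_abs_components) measurable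
  also have "(\<integral>\<^sup>+u. ?G u * ?I u \<partial>lborel) = ennreal (\<bar>sqrt g\<bar> ^ CARD('q)) * (\<integral>\<^sup>+w. ?G (0 + sqrt g *\<^sub>R w) * ?I (0 + sqrt g *\<^sub>R w) \<partial>lborel)"
    using g nn_integral_lborel_affine[of "\<lambda>u. ?G u * ?I u" "sqrt g" 0] by simp
  also have "2 ^ CARD('q) * \<dots> = (\<integral>\<^sup>+w. \<integral>\<^sup>+y. k y * (?I w * ennreal (kern g (y - \<mu>) w)) \<partial>lborel \<partial>lborel)"
  proof -
    have I: "?I (sqrt g *\<^sub>R w) = ?I w" for w using g by (simp add: indicator_def zero_le_mult_iff)
    let ?c = "ennreal (2 ^ CARD('q) * sqrt g ^ CARD('q))"
    have "(\<integral>\<^sup>+y. k y * (?I w * ennreal (kern g (y - \<mu>) w)) \<partial>lborel) = ?c * (?G (sqrt g *\<^sub>R w) * ?I w)" for w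
    proof -
      have "(\<integral>\<^sup>+y. k y * (?I w * ennreal (kern g (y - \<mu>) w)) \<partial>lborel)
         = (\<integral>\<^sup>+y. (?c * (?f (sqrt g *\<^sub>R w) * ?C) * ?I w) * (?f (?a (sqrt g *\<^sub>R w) y) * k y) \<partial>lborel)"
      proof (rule nn_integral_cong)
        fix y
        have "ennreal (kern g (y - \<mu>) w) = ?c * (?f (sqrt g *\<^sub>R w) * (?C * ?f (?a (sqrt g *\<^sub>R w) y)))"
          unfolding kern_eq[OF g, symmetric] using g std_mvn_density_nonneg
          by (intro ennreal_mult4) auto
        then show "k y * (?I w * ennreal (kern g (y - \<mu>) w))
            = (?c * (?f (sqrt g *\<^sub>R w) * ?C) * ?I w) * (?f (?a (sqrt g *\<^sub>R w) y) * k y)"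
          by (simp only: ac_simps)
      qed
      also have "\<dots> = (?c * (?f (sqrt g *\<^sub>R w) * ?C) * ?I w) * (\<integral>\<^sup>+y. (?f (?a (sqrt g *\<^sub>R w) y) * k y) \<partial>lborel)"
        by (rule nn_integral_cmult) measurable
      finally show ?thesis by (simp only: ac_simps)
    qed
    then have "(\<integral>\<^sup>+w. \<integral>\<^sup>+y. k y * (?I w * ennreal (kern g (y - \<mu>) w)) \<partial>lborel \<partial>lborel)
       = (\<integral>\<^sup>+w. ?c * (?G (sqrt g *\<^sub>R w) * ?I w) \<partial>lborel)" by simp
    also have "\<dots> = ?c * (\<integral>\<^sup>+w. ?G (sqrt g *\<^sub>R w) * ?I w \<partial>lborel)"
      by (rule nn_integral_cmult) measurable
    finally show ?thesis using g by (simp add: I ennreal_mult ennreal_power[symmetric] mult.assoc)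
  qed
  also have "\<dots> = (\<integral>\<^sup>+y. \<integral>\<^sup>+w. k y * (?I w * ennreal (kern g (y - \<mu>) w)) \<partial>lborel \<partial>lborel)"
    by (rule lborel_pair.Fubini') measurable
  also have "\<dots> = (\<integral>\<^sup>+y. k y * (\<integral>\<^sup>+w. ?I w * ennreal (kern g (y - \<mu>) w) \<partial>lborel) \<partial>lborel)"
    by (intro nn_integral_cong nn_integral_cmult) measurable
  finally show ?thesis .
qed

end

section \<open>Factorisation into \<open>t\<close> densities\<close>

text \<open>After taking logarithms the identity is linear in the logarithms of the factors. The
  powers of \<open>s\<close> and \<open>\<nu>\<close> cancel, and those of \<open>D\<close> cancel
  precisely because \<open>\<nu> = p + 2 * s\<close>.\<close>

lemma t_normalisation_powr:
  fixes \<beta> s D V p q \<nu> :: real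
  assumes "\<beta> > 0" "s > 0" "D > 0" "V > 0" "\<nu> > 0" and \<nu>: "\<nu> = p + 2 * s"
  shows "\<beta> powr (- p / 2) * s powr (p / 2) * (2 * s * pi) powr (- (p / 2)) * (D / (2 * \<beta>)) powr (- (2 * s + p) / 2)
     * (\<nu> / D) powr (q / 2) * (\<nu> * pi) powr (- (q / 2)) * (V / D) powr (- (\<nu> + q) / 2)
   = (2 * pi) powr (- (p + q) / 2) * \<beta> powr s * (V / 2) powr (- (s + (p + q) / 2))"
proof -
  have "ln (2 * s * pi) = ln 2 + ln s + ln pi" "ln (D / (2 * \<beta>)) = ln D - ln 2 - ln \<beta>"
    "ln (\<nu> / D) = ln \<nu> - ln D" "ln (\<nu> * pi) = ln \<nu> + ln pi" "ln (V / D) = ln V - ln D"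
    "ln (2 * pi) = ln 2 + ln pi" "ln (V / 2) = ln V - ln 2"
    using assms by (simp_all add: ln_mult ln_div)
  moreover have "- p / 2 * ln \<beta> + p / 2 * ln s + - (p / 2) * (ln 2 + ln s + ln pi)
      + - (2 * s + p) / 2 * (ln D - ln 2 - ln \<beta>) + q / 2 * (ln \<nu> - ln D)
      + - (q / 2) * (ln \<nu> + ln pi) + - (\<nu> + q) / 2 * (ln V - ln D)
    = - (p + q) / 2 * (ln 2 + ln pi) + s * ln \<beta> + - (s + (p + q) / 2) * (ln V - ln 2)"
    unfolding \<nu> by (simp add: field_simps)
  moreover have "\<beta> \<noteq> 0" "s \<noteq> 0" "2 * s * pi \<noteq> 0" "D / (2 * \<beta>) \<noteq> 0" "\<nu> / D \<noteq> 0" "\<nu> * pi \<noteq> 0" "V / D \<noteq> 0"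
    "2 * pi \<noteq> 0" "V / 2 \<noteq> 0"
    using assms(1-5) by auto
  ultimately show ?thesis
    by (simp only: powr_def exp_add[symmetric] if_False)
qed

lemma mvt_density_nonneg:
  fixes S :: "real^'n^'n"
  assumes "\<nu> > 0" "det S > 0"
  shows "mvt_density S \<nu> x \<ge> 0"
  unfolding mvt_density_def using assms by (intro mult_nonneg_nonneg divide_nonneg_nonneg) (auto intro!: less_imp_le Gamma_real_pos)

lemma borel_measurable_mvt_density [measurable]:
  "f \<in> borel_measurable N \<Longrightarrow> (\<lambda>z. mvt_density S \<nu> (f z)) \<in> borel_measurable N"
  unfolding mvt_density_def by measurable

context skew_scale
begin

definition "half_dim = (real CARD('p) + real CARD('q)) / 2"

text \<open>Up to constants, \<open>tkern \<beta> s x w\<close> is the joint \<open>t\<close> density of \<open>(x, w)\<close> with \<open>2 s\<close> degrees of freedom.\<close>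

definition "tkern \<beta> s x w = Gamma (s + half_dim) * (\<beta> + (maha x + resid x w) / 2) powr (- (s + half_dim))"
definition "tmix \<beta> s x = (\<integral>\<^sup>+w. indicator {w. \<forall>i. 0 \<le> w $ i} w * ennreal (tkern \<beta> s x w) \<partial>lborel)"
text \<open>The powers are the Jacobian of
  \<open>x \<mapsto> sqrt (s / \<beta>) *\<^sub>R x\<close>, so this is the t density with
  dispersion \<open>(\<beta> / s) *\<^sub>R \<Omega>\<close>.\<close>

definition "tcoef \<beta> s x = \<beta> powr (- real CARD('p) / 2) * s powr (real CARD('p) / 2)
   * mvt_density \<Omega> (2 * s) (sqrt (s / \<beta>) *\<^sub>R x)"
definition "tscale \<beta> s x = sqrt ((real CARD('p) + 2 * s) / (2 * \<beta> + maha x))"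
text \<open>Unlike \<open>mvt_cdf\<close> this is an \<open>emeasure\<close>, so the integral
  identities hold without knowing that the mass is finite.\<close>

definition "torth \<beta> s x = emeasure (density lborel (\<lambda>v. ennreal (mvt_density \<Delta> (real CARD('p) + 2 * s) v)))
   {v. \<forall>i. v $ i \<le> (tscale \<beta> s x *\<^sub>R mloc x) $ i}"

lemma measurable_tscale [measurable (raw)]:
  assumes [measurable]: "f \<in> borel_measurable N"
  shows "(\<lambda>z. tscale \<beta> s (f z)) \<in> borel_measurable N"
  unfolding tscale_def by measurable

lemma measurable_tkern [measurable (raw)]:
  assumes [measurable]: "f \<in> borel_measurable N" "h \<in> borel_measurable N"
  shows "(\<lambda>z. tkern \<beta> s (f z) (h z)) \<in> borel_measurable N"
  unfolding tkern_def by measurable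

lemma measurable_tmix [measurable (raw)]:
  assumes [measurable]: "f \<in> borel_measurable N"
  shows "(\<lambda>z. tmix \<beta> s (f z)) \<in> borel_measurable N"
proof -
  have "tmix \<beta> s \<in> borel_measurable borel" unfolding tmix_def by measurable
  from measurable_compose[OF assms this] show ?thesis .
qed

text \<open>The marginal t density is a power of \<open>D\<close> and the conditional one a power of
  \<open>V / D\<close>, with \<open>V = D + resid x w\<close>. The factor
  \<open>Gamma (\<nu> / 2)\<close> stands above in the first and below in the second, and the
  determinants merge by \<open>det_identity\<close>.\<close>

lemma t_factorisation:
  assumes "\<beta> > 0" "s > 0"
  shows "tcoef \<beta> s x * tscale \<beta> s x ^ CARD('q) * mvt_density \<Delta> (real CARD('p) + 2 * s) (tscale \<beta> s x *\<^sub>R mloc x + (- tscale \<beta> s x) *\<^sub>R w)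
    = norm_const * \<beta> powr s / Gamma s * tkern \<beta> s x w"
proof -
  define p where "p = real CARD('p)"
  define q where "q = real CARD('q)"
  define \<nu> where "\<nu> = p + 2 * s"
  define D where "D = 2 * \<beta> + maha x"
  define V where "V = D + resid x w"
  have pos: "p > 0" "q > 0" "\<nu> > 0" "D > 0" "V > 0"
    using assms maha_nonneg[of x] resid_nonneg[of x w] by (auto simp: p_def q_def \<nu>_def D_def V_def)
  have sc: "tscale \<beta> s x = sqrt (\<nu> / D)" by (simp add: tscale_def \<nu>_def D_def p_def)
  have scq: "tscale \<beta> s x ^ CARD('q) = (\<nu> / D) powr (q / 2)"
    using pos unfolding sc q_def
    by (simp add: powr_half_sqrt[symmetric] powr_powr powr_realpow[symmetric])
  have t1: "mvt_density \<Omega> (2 * s) (sqrt (s / \<beta>) *\<^sub>R x)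
     = Gamma (\<nu> / 2) / Gamma s / sqrt (det \<Omega>) * ((2 * s * pi) powr (- (p / 2)) * (D / (2 * \<beta>)) powr (- (2 * s + p) / 2))"
  proof -
    have "(sqrt (s / \<beta>) *\<^sub>R x) \<bullet> (matrix_inv \<Omega> *v (sqrt (s / \<beta>) *\<^sub>R x)) = s / \<beta> * maha x"
    proof -
      have "(sqrt (s / \<beta>) *\<^sub>R x) \<bullet> (matrix_inv \<Omega> *v (sqrt (s / \<beta>) *\<^sub>R x)) = (sqrt (s / \<beta>) * sqrt (s / \<beta>)) * maha x"
        by (simp only: matrix_vector_mult_scaleR inner_scaleR_left inner_scaleR_right maha_def mult.assoc)
      then show ?thesis using assms by (simp only: real_sqrt_mult_self) simp
    qed
    moreover have "1 + s / \<beta> * maha x / (2 * s) = D / (2 * \<beta>)" using assms by (simp add: D_def field_simps)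
    ultimately show ?thesis
      unfolding mvt_density_def p_def[symmetric] by (simp add: \<nu>_def powr_minus_divide ac_simps)
  qed
  have t2: "mvt_density \<Delta> \<nu> (tscale \<beta> s x *\<^sub>R mloc x + (- tscale \<beta> s x) *\<^sub>R w)
     = Gamma (s + half_dim) / Gamma (\<nu> / 2) / sqrt (det \<Delta>) * ((\<nu> * pi) powr (- (q / 2)) * (V / D) powr (- (\<nu> + q) / 2))"
  proof -
    let ?c = "tscale \<beta> s x"
    have "?c *\<^sub>R mloc x + (- ?c) *\<^sub>R w = (- ?c) *\<^sub>R (w - mloc x)" by (simp add: algebra_simps)
    then have "(?c *\<^sub>R mloc x + (- ?c) *\<^sub>R w) \<bullet> (matrix_inv \<Delta> *v (?c *\<^sub>R mloc x + (- ?c) *\<^sub>R w)) = ?c * ?c * resid x w"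
      by (simp only: matrix_vector_mult_scaleR resid_def inner_scaleR_left inner_scaleR_right)
    also have "?c * ?c = \<nu> / D" unfolding sc using pos by simp
    finally have h1: "1 + (?c *\<^sub>R mloc x + (- ?c) *\<^sub>R w) \<bullet> (matrix_inv \<Delta> *v (?c *\<^sub>R mloc x + (- ?c) *\<^sub>R w)) / \<nu> = V / D"
      using pos by (simp add: V_def field_simps)
    have h2: "(\<nu> + q) / 2 = s + half_dim" by (simp add: \<nu>_def half_dim_def p_def q_def field_simps)
    show ?thesis
      unfolding mvt_density_def q_def[symmetric] h1 h2 by (simp add: powr_minus_divide)
  qed
  have det: "sqrt (det \<Omega>) * sqrt (det \<Delta>) = \<bar>det S\<bar>"
    unfolding real_sqrt_mult[symmetric] det_identity by simp
  have "Gamma (\<nu> / 2) > 0" using pos by (intro Gamma_real_pos) auto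
  then have "tcoef \<beta> s x * tscale \<beta> s x ^ CARD('q) * mvt_density \<Delta> \<nu> (tscale \<beta> s x *\<^sub>R mloc x + (- tscale \<beta> s x) *\<^sub>R w)
     = Gamma (s + half_dim) / Gamma s / (sqrt (det \<Omega>) * sqrt (det \<Delta>)) *
       (\<beta> powr (- p / 2) * s powr (p / 2) * (2 * s * pi) powr (- (p / 2)) * (D / (2 * \<beta>)) powr (- (2 * s + p) / 2)
     * (\<nu> / D) powr (q / 2) * (\<nu> * pi) powr (- (q / 2)) * (V / D) powr (- (\<nu> + q) / 2))"
    unfolding tcoef_def t1 t2 scq p_def[symmetric] by simp
  also have "\<dots> = Gamma (s + half_dim) / Gamma s / \<bar>det S\<bar> *
     ((2 * pi) powr (- (p + q) / 2) * \<beta> powr s * (V / 2) powr (- (s + (p + q) / 2)))"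
    unfolding det by (subst t_normalisation_powr[OF assms pos(4,5,3) \<nu>_def]) (rule refl)
  also have "\<dots> = norm_const * \<beta> powr s / Gamma s * tkern \<beta> s x w"
  proof -
    have V2: "\<beta> + (maha x + resid x w) / 2 = V / 2" by (simp add: V_def D_def field_simps)
    show ?thesis
      unfolding tkern_def norm_const_def half_dim_def p_def[symmetric] q_def[symmetric] V2
      by (simp only: times_divide_eq_left times_divide_eq_right divide_divide_eq_left ac_simps)
  qed
  finally show ?thesis by (simp add: \<nu>_def p_def)
qed

lemma torth_eq:
  "torth \<beta> s x = (\<integral>\<^sup>+v. ennreal (mvt_density \<Delta> (real CARD('p) + 2 * s) v)
     * indicator {v. \<forall>i. v $ i \<le> (tscale \<beta> s x *\<^sub>R mloc x) $ i} v \<partial>lborel)"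
  unfolding torth_def by (rule emeasure_density) measurable

lemma tcoef_nonneg: "s > 0 \<Longrightarrow> tcoef \<beta> s x \<ge> 0"
  unfolding tcoef_def using pos_def_mat_det_pos[OF pos_def_\<Omega>]
  by (intro mult_nonneg_nonneg mvt_density_nonneg) auto

text \<open>For \<open>c = tscale \<beta> s x > 0\<close> the map \<open>v = c m - c w\<close>
  carries the orthant \<open>w \<ge> 0\<close> onto the lower set \<open>v \<le> c m\<close>. This
  is how an integral over nonnegative \<open>w\<close> becomes a distribution function at
  \<open>c m\<close>.\<close>

lemma tcoef_torth:
  assumes "\<beta> > 0" "s > 0"
  shows "ennreal (tcoef \<beta> s x) * torth \<beta> s x = ennreal (norm_const * \<beta> powr s / Gamma s) * tmix \<beta> s x"
proof -
  let ?t = "\<lambda>v. ennreal (mvt_density \<Delta> (real CARD('p) + 2 * s) v)"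
  let ?c = "tscale \<beta> s x"
  have c: "?c > 0" using assms maha_nonneg[of x] by (simp add: tscale_def add_pos_nonneg)
  let ?J = "\<lambda>v. indicator {v. \<forall>i. v $ i \<le> (?c *\<^sub>R mloc x) $ i} v :: ennreal"
  let ?I = "\<lambda>w::real^'q. indicator {w. \<forall>i. 0 \<le> w $ i} w :: ennreal"
  let ?a = "\<lambda>w. ?c *\<^sub>R mloc x + (- ?c) *\<^sub>R w"
  have J: "?J (?a w) = ?I w" for w using c by (simp add: indicator_def zero_le_mult_iff)
  have "torth \<beta> s x = ennreal (\<bar>- ?c\<bar> ^ CARD('q)) * (\<integral>\<^sup>+w. ?t (?a w) * ?J (?a w) \<partial>lborel)"
    unfolding torth_eq using c nn_integral_lborel_affine[of "\<lambda>v. ?t v * ?J v" "- ?c" "?c *\<^sub>R mloc x"] by simp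
  then have "ennreal (tcoef \<beta> s x) * torth \<beta> s x
     = (ennreal (tcoef \<beta> s x) * ennreal (?c ^ CARD('q))) * (\<integral>\<^sup>+w. ?t (?a w) * ?I w \<partial>lborel)"
    unfolding J using c by (simp add: mult.assoc)
  also have "\<dots> = (\<integral>\<^sup>+w. (ennreal (tcoef \<beta> s x) * ennreal (?c ^ CARD('q))) * (?t (?a w) * ?I w) \<partial>lborel)"
    by (rule nn_integral_cmult[symmetric]) measurable
  also have "\<dots> = (\<integral>\<^sup>+w. ennreal (norm_const * \<beta> powr s / Gamma s) * (?I w * ennreal (tkern \<beta> s x w)) \<partial>lborel)"
  proof (rule nn_integral_cong)
    fix w
    have "ennreal (tcoef \<beta> s x) * ennreal (?c ^ CARD('q)) * ?t (?a w)
        = ennreal (tcoef \<beta> s x * ?c ^ CARD('q) * mvt_density \<Delta> (real CARD('p) + 2 * s) (?a w))"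
      using c tcoef_nonneg[OF assms(2)] by (simp add: ennreal_mult')
    also have "\<dots> = ennreal (norm_const * \<beta> powr s / Gamma s) * ennreal (tkern \<beta> s x w)"
      unfolding t_factorisation[OF assms]
      by (rule ennreal_mult') (use norm_const_nonneg Gamma_real_pos[OF assms(2)] in simp)
    finally show "(ennreal (tcoef \<beta> s x) * ennreal (?c ^ CARD('q))) * (?t (?a w) * ?I w)
      = ennreal (norm_const * \<beta> powr s / Gamma s) * (?I w * ennreal (tkern \<beta> s x w))"
      by (simp only: mult.assoc[symmetric]) (simp only: ac_simps)
  qed
  also have "\<dots> = ennreal (norm_const * \<beta> powr s / Gamma s) * tmix \<beta> s x"
    unfolding tmix_def by (rule nn_integral_cmult) measurable
  finally show ?thesis .
qed

lemma measurable_torth [measurable (raw)]: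
  assumes [measurable]: "f \<in> borel_measurable N"
  shows "(\<lambda>z. torth \<beta> s (f z)) \<in> borel_measurable N"
proof -
  \<comment> \<open>The set varies with \<open>x\<close>; written into the integrand, it becomes
    part of a jointly measurable function.\<close>
  have eq: "torth \<beta> s x = (\<integral>\<^sup>+v. (if \<forall>i. v $ i \<le> tscale \<beta> s x * mloc x $ i
      then ennreal (mvt_density \<Delta> (real CARD('p) + 2 * s) v) else 0) \<partial>lborel)" for x
    unfolding torth_eq by (intro nn_integral_cong) (simp add: indicator_def)
  have "(\<lambda>x. torth \<beta> s x) \<in> borel_measurable borel"
    unfolding eq by measurable
  from measurable_compose[OF assms this] show ?thesis .
qed

lemma measurable_tcoef [measurable (raw)]:
  assumes [measurable]: "f \<in> borel_measurable N"
  shows "(\<lambda>z. tcoef \<beta> s (f z)) \<in> borel_measurable N"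
  unfolding tcoef_def by measurable

end

section \<open>The mixture density\<close>

lemma borel_measurable_gen_lindley_density [measurable]:
  "gen_lindley_density \<omega> \<beta> \<gamma> \<in> borel_measurable borel"
  unfolding gen_lindley_density_def by measurable

lemma gen_lindley_density_nonneg:
  assumes "\<omega> > 0" "\<beta> > 0" "\<gamma> \<ge> 0"
  shows "gen_lindley_density \<omega> \<beta> \<gamma> g \<ge> 0"
  using assms Gamma_real_pos[of "\<omega> + 1"] by (auto simp: gen_lindley_density_def intro!: mult_nonneg_nonneg divide_nonneg_nonneg)

text \<open>\<open>enn2real\<close> sends infinity to 0, so finiteness has to be assumed; it is
  assumed of the product only, since for \<open>a = 0\<close> both sides vanish whatever
  \<open>E\<close> is.\<close>

lemma ennreal_mult_enn2real:
  assumes "a \<ge> 0" "ennreal a * E \<noteq> \<top>"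
  shows "ennreal (a * enn2real E) = ennreal a * E"
proof (cases "a = 0")
  case False
  then have "E \<noteq> \<top>" using assms by (auto simp: ennreal_mult_top)
  then show ?thesis using assms by (simp add: ennreal_mult' less_top)
qed simp

context skew_scale
begin

text \<open>The two summands \<open>\<omega>\<close> and \<open>\<gamma> g\<close> of the Lindley density make it a mixture of the gamma
  densities with shapes \<open>\<omega>\<close> and \<open>\<omega> + 1\<close>; hence the two terms.\<close>

lemma nn_integral_lindley_kern:
  assumes "\<omega> > 0" "\<beta> > 0" "\<gamma> \<ge> 0"
  shows "(\<integral>\<^sup>+g. ennreal (gen_lindley_density \<omega> \<beta> \<gamma> g) * ennreal (kern g x w) \<partial>lborel)
    = ennreal (2 ^ CARD('q) * (\<beta> / (\<beta> + \<gamma>)) * (norm_const * \<beta> powr \<omega> / Gamma \<omega>)) * ennreal (tkern \<beta> \<omega> x w)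
    + ennreal (2 ^ CARD('q) * (\<gamma> / (\<beta> + \<gamma>)) * (norm_const * \<beta> powr (\<omega> + 1) / Gamma (\<omega> + 1))) * ennreal (tkern \<beta> (\<omega> + 1) x w)"
proof -
  \<comment> \<open>Mixture weights \<open>\<beta> / (\<beta> + \<gamma>)\<close> and
    \<open>\<gamma> / (\<beta> + \<gamma>)\<close>, each with the constant
    \<open>\<beta> powr s / Gamma s\<close> of its gamma density.\<close>
  let ?a1 = "2 ^ CARD('q) * (\<beta> / (\<beta> + \<gamma>)) * (norm_const * \<beta> powr \<omega> / Gamma \<omega>)"
  let ?a2 = "2 ^ CARD('q) * (\<gamma> / (\<beta> + \<gamma>)) * (norm_const * \<beta> powr (\<omega> + 1) / Gamma (\<omega> + 1))"
  \<comment> \<open>The total rate: \<open>\<beta>\<close> from the Lindley density plus half the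
    quadratic form from \<open>kern\<close>.\<close>
  define B where "B = \<beta> + (maha x + resid x w) / 2"
  have B: "B > 0" using assms maha_nonneg[of x] resid_nonneg[of x w] by (simp add: B_def add_pos_nonneg)
  have hd: "half_dim > 0" by (simp add: half_dim_def add_pos_nonneg)
  have G: "Gamma \<omega> > 0" "Gamma (\<omega> + 1) > 0" using assms by (simp_all add: Gamma_real_pos)
  have a: "?a1 \<ge> 0" "?a2 \<ge> 0" using assms G norm_const_nonneg by auto
  let ?g = "\<lambda>s g. indicator {0<..} g * g powr (s + half_dim - 1) * exp (- B * g) :: real"
  have gam: "(\<integral>\<^sup>+g. ennreal (?g s g) \<partial>lborel) = ennreal (tkern \<beta> s x w)" if "s > 0" for s
  proof -
    have "(\<integral>\<^sup>+g. ennreal (?g s g) \<partial>lborel) = ennreal (Gamma (s + half_dim) / B powr (s + half_dim))"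
      by (rule nn_integral_gamma) (use that hd B in auto)
    then show ?thesis unfolding tkern_def B_def[symmetric] powr_minus_divide by simp
  qed
  have pt: "gen_lindley_density \<omega> \<beta> \<gamma> g * kern g x w = ?a1 * ?g \<omega> g + ?a2 * ?g (\<omega> + 1) g" for g
  proof (cases "g > 0")
    case True
    have e: "exp (- \<beta> * g) * exp (- (g / 2) * (maha x + resid x w)) = exp (- B * g)"
      unfolding exp_add[symmetric] B_def by (simp add: field_simps)
    have p1: "g powr (\<omega> - 1) * g powr half_dim = g powr (\<omega> + half_dim - 1)"
      unfolding powr_add[symmetric] by (simp add: algebra_simps)
    have p2: "g powr (\<omega> + 1 + half_dim - 1) = g powr (\<omega> + half_dim - 1) * g"
      using True powr_add[of g "\<omega> + half_dim - 1" 1] by (simp add: algebra_simps)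
    have p3: "\<beta> powr (\<omega> + 1) = \<beta> powr \<omega> * \<beta>" using assms by (simp add: powr_add)
    \<comment> \<open>This cancels the factor \<open>\<omega>\<close> of the first Lindley summand,
      leaving a gamma density of shape \<open>\<omega>\<close>.\<close>
    have G1: "Gamma (\<omega> + 1) = \<omega> * Gamma \<omega>"
      using assms by (intro Gamma_plus1) (auto elim!: nonpos_Ints_cases)
    have "gen_lindley_density \<omega> \<beta> \<gamma> g * kern g x w = \<beta> powr (\<omega> + 1) * (\<omega> + \<gamma> * g) / ((\<beta> + \<gamma>) * Gamma (\<omega> + 1))
      * (2 ^ CARD('q) * norm_const) * (g powr (\<omega> - 1) * g powr half_dim) * (exp (- \<beta> * g) * exp (- (g / 2) * (maha x + resid x w)))"
      using True unfolding gen_lindley_density_def kern_def half_dim_def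
      by (simp only: if_True times_divide_eq_left times_divide_eq_right divide_divide_eq_left ac_simps)
    also have "\<dots> = ?a1 * ?g \<omega> g + ?a2 * ?g (\<omega> + 1) g"
      unfolding e p1 p2 using True assms G unfolding p3 G1 by (simp add: divide_simps) (simp add: algebra_simps)
    finally show ?thesis .
  qed (simp add: gen_lindley_density_def)
  have "ennreal (gen_lindley_density \<omega> \<beta> \<gamma> g) * ennreal (kern g x w)
     = ennreal ?a1 * ennreal (?g \<omega> g) + ennreal ?a2 * ennreal (?g (\<omega> + 1) g)" for g
  proof -
    have "ennreal (gen_lindley_density \<omega> \<beta> \<gamma> g) * ennreal (kern g x w) = ennreal (gen_lindley_density \<omega> \<beta> \<gamma> g * kern g x w)"
      using gen_lindley_density_nonneg[OF assms] by (simp add: ennreal_mult')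
    also have "\<dots> = ennreal (?a1 * ?g \<omega> g) + ennreal (?a2 * ?g (\<omega> + 1) g)"
      unfolding pt by (rule ennreal_plus; rule mult_nonneg_nonneg, rule a) auto
    finally show ?thesis unfolding ennreal_mult'[OF a(1)] ennreal_mult'[OF a(2)] .
  qed
  then have "(\<integral>\<^sup>+g. ennreal (gen_lindley_density \<omega> \<beta> \<gamma> g) * ennreal (kern g x w) \<partial>lborel)
    = (\<integral>\<^sup>+g. ennreal ?a1 * ennreal (?g \<omega> g) + ennreal ?a2 * ennreal (?g (\<omega> + 1) g) \<partial>lborel)"
    by simp
  also have "\<dots> = ennreal ?a1 * (\<integral>\<^sup>+g. ennreal (?g \<omega> g) \<partial>lborel) + ennreal ?a2 * (\<integral>\<^sup>+g. ennreal (?g (\<omega> + 1) g) \<partial>lborel)"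
    by (subst nn_integral_add) (auto intro!: arg_cong2[where f = "(+)"] nn_integral_cmult)
  also have "(\<integral>\<^sup>+g. ennreal (?g \<omega> g) \<partial>lborel) = ennreal (tkern \<beta> \<omega> x w)"
    by (rule gam) fact
  also have "(\<integral>\<^sup>+g. ennreal (?g (\<omega> + 1) g) \<partial>lborel) = ennreal (tkern \<beta> (\<omega> + 1) x w)"
    by (rule gam) (use assms in simp)
  finally show ?thesis .
qed

definition "skew_density \<omega> \<beta> \<gamma> x =
   ennreal (2 ^ CARD('q) * (\<beta> / (\<beta> + \<gamma>)) * tcoef \<beta> \<omega> x) * torth \<beta> \<omega> x
 + ennreal (2 ^ CARD('q) * (\<gamma> / (\<beta> + \<gamma>)) * tcoef \<beta> (\<omega> + 1) x) * torth \<beta> (\<omega> + 1) x"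

lemma measurable_skew_density [measurable (raw)]:
  assumes [measurable]: "f \<in> borel_measurable N"
  shows "(\<lambda>z. skew_density \<omega> \<beta> \<gamma> (f z)) \<in> borel_measurable N"
  unfolding skew_density_def by measurable

lemma nn_integral_mixture:
  assumes pos: "\<omega> > 0" "\<beta> > 0" "\<gamma> \<ge> 0"
  shows "(\<integral>\<^sup>+w. indicator {w. \<forall>i. 0 \<le> w $ i} w *
      (\<integral>\<^sup>+g. ennreal (gen_lindley_density \<omega> \<beta> \<gamma> g) * ennreal (kern g x w) \<partial>lborel) \<partial>lborel)
    = skew_density \<omega> \<beta> \<gamma> x"
proof -
  let ?I = "\<lambda>w::real^'q. indicator {w. \<forall>i. 0 \<le> w $ i} w :: ennreal"
  let ?b1 = "norm_const * \<beta> powr \<omega> / Gamma \<omega>" and ?b2 = "norm_const * \<beta> powr (\<omega> + 1) / Gamma (\<omega> + 1)"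
  let ?c1 = "2 ^ CARD('q) * (\<beta> / (\<beta> + \<gamma>))" and ?c2 = "2 ^ CARD('q) * (\<gamma> / (\<beta> + \<gamma>))"
  have "(\<integral>\<^sup>+w. ?I w * (\<integral>\<^sup>+g. ennreal (gen_lindley_density \<omega> \<beta> \<gamma> g) * ennreal (kern g x w) \<partial>lborel) \<partial>lborel)
    = (\<integral>\<^sup>+w. ennreal (?c1 * ?b1) * (?I w * ennreal (tkern \<beta> \<omega> x w)) + ennreal (?c2 * ?b2) * (?I w * ennreal (tkern \<beta> (\<omega> + 1) x w)) \<partial>lborel)"
    unfolding nn_integral_lindley_kern[OF pos] by (simp only: distrib_left ac_simps)
  also have "\<dots> = ennreal (?c1 * ?b1) * tmix \<beta> \<omega> x + ennreal (?c2 * ?b2) * tmix \<beta> (\<omega> + 1) x"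
    unfolding tmix_def by (subst nn_integral_add) (auto intro!: arg_cong2[where f = "(+)"] nn_integral_cmult)
  also have "\<dots> = ennreal ?c1 * (ennreal ?b1 * tmix \<beta> \<omega> x) + ennreal ?c2 * (ennreal ?b2 * tmix \<beta> (\<omega> + 1) x)"
  proof -
    have c: "?c1 \<ge> 0" "?c2 \<ge> 0" using pos by auto
    show ?thesis unfolding ennreal_mult'[OF c(1)] ennreal_mult'[OF c(2)] by (simp only: mult.assoc)
  qed
  \<comment> \<open>\<open>?b1\<close> and \<open>?b2\<close> are the constants of
    \<open>tcoef_torth\<close> at \<open>s = \<omega>\<close> and
    \<open>s = \<omega> + 1\<close>.\<close>
  also have "\<dots> = ennreal ?c1 * (ennreal (tcoef \<beta> \<omega> x) * torth \<beta> \<omega> x) + ennreal ?c2 * (ennreal (tcoef \<beta> (\<omega> + 1) x) * torth \<beta> (\<omega> + 1) x)"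
    using pos by (simp add: tcoef_torth)
  also have "\<dots> = skew_density \<omega> \<beta> \<gamma> x"
  proof -
    have c: "?c1 \<ge> 0" "?c2 \<ge> 0" using pos by auto
    show ?thesis unfolding skew_density_def ennreal_mult'[OF c(1)] ennreal_mult'[OF c(2)] by (simp only: mult.assoc)
  qed
  finally show ?thesis .
qed

text \<open>Two exchanges of integrals move \<open>g\<close> from the outermost to the innermost
  place, where its gamma integral is known. Values \<open>g \<le> 0\<close> drop out because the
  Lindley density vanishes there.\<close>

lemma nn_integral_skew_scale:
  assumes pos: "\<omega> > 0" "\<beta> > 0" "\<gamma> \<ge> 0" and [measurable]: "k \<in> borel_measurable borel"
  shows "(\<integral>\<^sup>+g. ennreal (gen_lindley_density \<omega> \<beta> \<gamma> g) * (\<integral>\<^sup>+z0. ennreal (std_mvn_density z0) * (\<integral>\<^sup>+z1. ennreal (std_mvn_density z1) *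
        k (\<mu> + (1 / sqrt g) *\<^sub>R (L *v (\<chi> i. \<bar>z0 $ i\<bar>) + S *v z1)) \<partial>lborel) \<partial>lborel) \<partial>lborel)
    = (\<integral>\<^sup>+y. k y * skew_density \<omega> \<beta> \<gamma> (y - \<mu>) \<partial>lborel)"
    (is "(\<integral>\<^sup>+g. ?f g * ?inner g \<partial>lborel) = _")
proof -
  let ?I = "\<lambda>w::real^'q. indicator {w. \<forall>i. 0 \<le> w $ i} w :: ennreal"
  let ?K = "\<lambda>g y w. ennreal (kern g (y - \<mu>) w)"
  have "(\<integral>\<^sup>+g. ?f g * ?inner g \<partial>lborel) = (\<integral>\<^sup>+g. ?f g * (\<integral>\<^sup>+y. k y * (\<integral>\<^sup>+w. ?I w * ?K g y w \<partial>lborel) \<partial>lborel) \<partial>lborel)"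
  proof (rule nn_integral_cong)
    fix g
    show "?f g * ?inner g = ?f g * (\<integral>\<^sup>+y. k y * (\<integral>\<^sup>+w. ?I w * ?K g y w \<partial>lborel) \<partial>lborel)"
    proof (cases "g > 0")
      case True
      then show ?thesis by (subst nn_integral_given_scale) auto
    qed (simp add: gen_lindley_density_def)
  qed
  also have "\<dots> = (\<integral>\<^sup>+g. \<integral>\<^sup>+y. k y * (?f g * (\<integral>\<^sup>+w. ?I w * ?K g y w \<partial>lborel)) \<partial>lborel \<partial>lborel)"
    by (subst nn_integral_cmult[symmetric]) (auto simp: ac_simps)
  also have "\<dots> = (\<integral>\<^sup>+y. \<integral>\<^sup>+g. k y * (?f g * (\<integral>\<^sup>+w. ?I w * ?K g y w \<partial>lborel)) \<partial>lborel \<partial>lborel)"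
    by (rule lborel_pair.Fubini') measurable
  also have "\<dots> = (\<integral>\<^sup>+y. k y * (\<integral>\<^sup>+g. ?f g * (\<integral>\<^sup>+w. ?I w * ?K g y w \<partial>lborel) \<partial>lborel) \<partial>lborel)"
    by (intro nn_integral_cong nn_integral_cmult) measurable
  also have "\<dots> = (\<integral>\<^sup>+y. k y * skew_density \<omega> \<beta> \<gamma> (y - \<mu>) \<partial>lborel)"
  proof (rule nn_integral_cong)
    fix y
    have "(\<integral>\<^sup>+g. ?f g * (\<integral>\<^sup>+w. ?I w * ?K g y w \<partial>lborel) \<partial>lborel) = (\<integral>\<^sup>+g. \<integral>\<^sup>+w. ?I w * (?f g * ?K g y w) \<partial>lborel \<partial>lborel)"
      by (subst nn_integral_cmult[symmetric]) (auto simp: ac_simps)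
    also have "\<dots> = (\<integral>\<^sup>+w. \<integral>\<^sup>+g. ?I w * (?f g * ?K g y w) \<partial>lborel \<partial>lborel)"
      by (rule lborel_pair.Fubini') measurable
    also have "\<dots> = (\<integral>\<^sup>+w. ?I w * (\<integral>\<^sup>+g. ?f g * ?K g y w \<partial>lborel) \<partial>lborel)"
      by (intro nn_integral_cong nn_integral_cmult) measurable
    also have "\<dots> = skew_density \<omega> \<beta> \<gamma> (y - \<mu>)" by (rule nn_integral_mixture[OF pos])
    finally show "k y * (\<integral>\<^sup>+g. ?f g * (\<integral>\<^sup>+w. ?I w * ?K g y w \<partial>lborel) \<partial>lborel) = k y * skew_density \<omega> \<beta> \<gamma> (y - \<mu>)"
      by simp
  qed
  finally show ?thesis .
qed

end

theorem mainTheorem1: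
  fixes M :: "'s measure"
    and \<mu> :: "real^'p" and \<Sigma> :: "real^'p^'p" and S :: "real^'p^'p"
    and \<Lambda> :: "real^'q^'p"
    and \<omega> \<beta> \<gamma> :: real
    and Z0 :: "'s \<Rightarrow> real^'q" and Z1 :: "'s \<Rightarrow> real^'p" and G :: "'s \<Rightarrow> real"
  assumes "prob_space M"
    and "pos_def_mat \<Sigma>"
    and "S ** transpose S = \<Sigma>"
    and "\<omega> > 0" and "\<beta> > 0" and "\<gamma> \<ge> 0"
    and "distributed M lborel Z0 (\<lambda>z. ennreal (std_mvn_density z))"
    and "distributed M lborel Z1 (\<lambda>z. ennreal (std_mvn_density z))"
    and "distributed M lborel G (\<lambda>g. ennreal (gen_lindley_density \<omega> \<beta> \<gamma> g))"
    and "prob_space.indep_sets M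
           (\<lambda>i::nat. if i = 0 then {Z0 -` A \<inter> space M | A. A \<in> sets borel}
                      else if i = 1 then {Z1 -` A \<inter> space M | A. A \<in> sets borel}
                      else {G -` A \<inter> space M | A. A \<in> sets borel}) {0, 1, 2}"
  shows "distributed M lborel
           (\<lambda>s. \<mu> + (1 / sqrt (G s)) *\<^sub>R (\<Lambda> *v (\<chi> i. \<bar>Z0 s $ i\<bar>) + S *v Z1 s))
           (\<lambda>y. ennreal (
              let \<Omega> = \<Sigma> + \<Lambda> ** transpose \<Lambda>;
                  \<Delta> = mat 1 - transpose \<Lambda> ** matrix_inv \<Omega> ** \<Lambda>;
                  m = transpose \<Lambda> *v (matrix_inv \<Omega> *v (y - \<mu>));
                  d = (y - \<mu>) \<bullet> (matrix_inv \<Omega> *v (y - \<mu>));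
                  p = real CARD('p); q = real CARD('q)
              in 2 powr q * \<beta> powr (1 - p / 2) * \<omega> powr (p / 2) / (\<beta> + \<gamma>)
                   * mvt_density \<Omega> (2 * \<omega>) (sqrt (\<omega> / \<beta>) *\<^sub>R (y - \<mu>))
                   * mvt_cdf \<Delta> (p + 2 * \<omega>) (sqrt ((p + 2 * \<omega>) / (2 * \<beta> + d)) *\<^sub>R m)
                 + 2 powr q * \<gamma> * \<beta> powr (- p / 2) * (\<omega> + 1) powr (p / 2) / (\<beta> + \<gamma>)
                   * mvt_density \<Omega> (2 * \<omega> + 2) (sqrt ((\<omega> + 1) / \<beta>) *\<^sub>R (y - \<mu>))
                   * mvt_cdf \<Delta> (p + 2 * \<omega> + 2) (sqrt ((p + 2 * \<omega> + 2) / (2 * \<beta> + d)) *\<^sub>R m)))"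
proof -
  interpret prob_space M by fact
  interpret skew_scale \<Sigma> S \<Lambda> by standard fact+
  let ?Y = "\<lambda>s. \<mu> + (1 / sqrt (G s)) *\<^sub>R (\<Lambda> *v (\<chi> i. \<bar>Z0 s $ i\<bar>) + S *v Z1 s)"
  note pos = \<open>\<omega> > 0\<close> \<open>\<beta> > 0\<close> \<open>\<gamma> \<ge> 0\<close>
  have [measurable]: "Z0 \<in> borel_measurable M" "Z1 \<in> borel_measurable M" "G \<in> borel_measurable M"
    using assms(7-9)[THEN distributed_measurable] by simp_all
  have indep: "prob (G -` A \<inter> Z0 -` B \<inter> Z1 -` C \<inter> space M)
      = prob (G -` A \<inter> space M) * prob (Z0 -` B \<inter> space M) * prob (Z1 -` C \<inter> space M)"
    if "A \<in> sets lborel" "B \<in> sets lborel" "C \<in> sets lborel" for A B C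
  proof -
    let ?E = "\<lambda>i::nat. if i = 0 then Z0 -` B \<inter> space M else if i = 1 then Z1 -` C \<inter> space M else G -` A \<inter> space M"
    have "prob (\<Inter>j\<in>{0, 1, 2}. ?E j) = (\<Prod>j\<in>{0, 1, 2}. prob (?E j))"
      using that by (intro indep_setsD[OF assms(10)]) auto
    moreover have "(\<Inter>j\<in>{0, 1, 2}. ?E j) = G -` A \<inter> Z0 -` B \<inter> Z1 -` C \<inter> space M" by auto
    ultimately show ?thesis by simp
  qed
  have law: "(\<integral>\<^sup>+s. k (?Y s) \<partial>M) = (\<integral>\<^sup>+y. k y * skew_density \<omega> \<beta> \<gamma> (y - \<mu>) \<partial>lborel)"
    if [measurable]: "k \<in> borel_measurable borel" for k
  proof -
    let ?H = "\<lambda>(g, z0, z1). k (\<mu> + (1 / sqrt g) *\<^sub>R (\<Lambda> *v (\<chi> i. \<bar>z0 $ i\<bar>) + S *v z1))"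
    have "(\<integral>\<^sup>+s. ?H (G s, Z0 s, Z1 s) \<partial>M)
      = (\<integral>\<^sup>+g. ennreal (gen_lindley_density \<omega> \<beta> \<gamma> g) * (\<integral>\<^sup>+z0. ennreal (std_mvn_density z0) *
          (\<integral>\<^sup>+z1. ennreal (std_mvn_density z1) * ?H (g, z0, z1) \<partial>lborel) \<partial>lborel) \<partial>lborel)"
      by (rule nn_integral_indep_triple[OF assms(9,7,8) sigma_finite_lborel sigma_finite_lborel sigma_finite_lborel indep])
         (simp_all, measurable)
    then show ?thesis by (simp add: nn_integral_skew_scale[OF pos])
  qed
  let ?c1 = "2 ^ CARD('q) * (\<beta> / (\<beta> + \<gamma>))" and ?c2 = "2 ^ CARD('q) * (\<gamma> / (\<beta> + \<gamma>))"
  \<comment> \<open>The real-valued form of \<open>skew_density\<close>; the two agree wherever the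
    latter is finite.\<close>
  define dens where "dens x = ?c1 * tcoef \<beta> \<omega> x * enn2real (torth \<beta> \<omega> x)
    + ?c2 * tcoef \<beta> (\<omega> + 1) x * enn2real (torth \<beta> (\<omega> + 1) x)" for x
  have [measurable]: "dens \<in> borel_measurable borel" unfolding dens_def by measurable
  have target: "(let \<Omega> = \<Sigma> + \<Lambda> ** transpose \<Lambda>;
                  \<Delta> = mat 1 - transpose \<Lambda> ** matrix_inv \<Omega> ** \<Lambda>;
                  m = transpose \<Lambda> *v (matrix_inv \<Omega> *v (y - \<mu>));
                  d = (y - \<mu>) \<bullet> (matrix_inv \<Omega> *v (y - \<mu>));
                  p = real CARD('p); q = real CARD('q)
              in 2 powr q * \<beta> powr (1 - p / 2) * \<omega> powr (p / 2) / (\<beta> + \<gamma>)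
                   * mvt_density \<Omega> (2 * \<omega>) (sqrt (\<omega> / \<beta>) *\<^sub>R (y - \<mu>))
                   * mvt_cdf \<Delta> (p + 2 * \<omega>) (sqrt ((p + 2 * \<omega>) / (2 * \<beta> + d)) *\<^sub>R m)
                 + 2 powr q * \<gamma> * \<beta> powr (- p / 2) * (\<omega> + 1) powr (p / 2) / (\<beta> + \<gamma>)
                   * mvt_density \<Omega> (2 * \<omega> + 2) (sqrt ((\<omega> + 1) / \<beta>) *\<^sub>R (y - \<mu>))
                   * mvt_cdf \<Delta> (p + 2 * \<omega> + 2) (sqrt ((p + 2 * \<omega> + 2) / (2 * \<beta> + d)) *\<^sub>R m)) = dens (y - \<mu>)" for y
  proof -
    have cdf: "mvt_cdf \<Delta> (real CARD('p) + 2 * s) (sqrt ((real CARD('p) + 2 * s) / (2 * \<beta> + maha x)) *\<^sub>R mloc x)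
       = enn2real (torth \<beta> s x)" for s x
      unfolding mvt_cdf_def torth_def tscale_def measure_def ..
    have e: "2 * \<omega> + 2 = 2 * (\<omega> + 1)" "real CARD('p) + 2 * \<omega> + 2 = real CARD('p) + 2 * (\<omega> + 1)" by simp_all
    \<comment> \<open>The extra \<open>\<beta>\<close> in the first term of the stated density is
      the numerator of its mixture weight.\<close>
    have b: "\<beta> powr (1 - real CARD('p) / 2) = \<beta> * \<beta> powr (- real CARD('p) / 2)"
      using pos by (simp add: powr_diff powr_minus_divide)
    have two: "(2::real) powr real CARD('q) = 2 ^ CARD('q)" by (simp add: powr_realpow)
    show ?thesis
      unfolding Let_def \<Omega>_def[symmetric] \<Delta>_def[symmetric] mloc_def[symmetric] maha_def[symmetric] e cdf b two dens_def tcoef_def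
      by (simp only: times_divide_eq_left times_divide_eq_right ac_simps)
  qed
  \<comment> \<open>The constant test function 1 yields the total mass without evaluating any t
    integral.\<close>
  have "(\<integral>\<^sup>+y. skew_density \<omega> \<beta> \<gamma> (y - \<mu>) \<partial>lborel) = 1"
    using law[of "\<lambda>_. 1"] by (simp add: emeasure_space_1)
  then have fin: "AE y in lborel. skew_density \<omega> \<beta> \<gamma> (y - \<mu>) \<noteq> \<infinity>"
    by (intro nn_integral_PInf_AE) auto
  \<comment> \<open>\<open>mvt_cdf\<close> is a real-valued \<open>measure\<close>, so it is junk where the orthant has infinite mass;
    the total mass 1 confines this to a null set.\<close>
  have AE_eq: "AE y in lborel. skew_density \<omega> \<beta> \<gamma> (y - \<mu>) = ennreal (dens (y - \<mu>))"
    using fin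
  proof eventually_elim
    fix y assume fin: "skew_density \<omega> \<beta> \<gamma> (y - \<mu>) \<noteq> \<infinity>"
    let ?x = "y - \<mu>"
    have c: "?c1 * tcoef \<beta> \<omega> ?x \<ge> 0" "?c2 * tcoef \<beta> (\<omega> + 1) ?x \<ge> 0"
      using pos tcoef_nonneg[of \<omega>] tcoef_nonneg[of "\<omega> + 1"] by auto
    have "ennreal (dens ?x) = ennreal (?c1 * tcoef \<beta> \<omega> ?x * enn2real (torth \<beta> \<omega> ?x))
       + ennreal (?c2 * tcoef \<beta> (\<omega> + 1) ?x * enn2real (torth \<beta> (\<omega> + 1) ?x))"
      unfolding dens_def by (rule ennreal_plus; rule mult_nonneg_nonneg, rule c) auto
    also have "\<dots> = skew_density \<omega> \<beta> \<gamma> ?x"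
      using fin unfolding skew_density_def
      by (subst (1 2) ennreal_mult_enn2real) (use c in auto)
    finally show "skew_density \<omega> \<beta> \<gamma> ?x = ennreal (dens ?x)" ..
  qed
  show ?thesis
    unfolding target distributed_def
  proof (intro conjI)
    show "distr M lborel ?Y = density lborel (\<lambda>y. ennreal (dens (y - \<mu>)))"
    proof (rule measure_eqI)
      fix A assume "A \<in> sets (distr M lborel ?Y)"
      then have [measurable]: "A \<in> sets borel" by simp
      have "emeasure (distr M lborel ?Y) A = (\<integral>\<^sup>+y. indicator A y \<partial>distr M lborel ?Y)"
        by simp
      also have "\<dots> = (\<integral>\<^sup>+s. indicator A (?Y s) \<partial>M)"
        by (rule nn_integral_distr) simp_all
      also have "\<dots> = (\<integral>\<^sup>+y. indicator A y * skew_density \<omega> \<beta> \<gamma> (y - \<mu>) \<partial>lborel)"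
        by (rule law) measurable
      also have "\<dots> = (\<integral>\<^sup>+y. ennreal (dens (y - \<mu>)) * indicator A y \<partial>lborel)"
        by (rule nn_integral_cong_AE) (use AE_eq in eventually_elim, simp add: mult.commute)
      also have "\<dots> = emeasure (density lborel (\<lambda>y. ennreal (dens (y - \<mu>)))) A"
        by (rule emeasure_density[symmetric]) measurable
      finally show "emeasure (distr M lborel ?Y) A = emeasure (density lborel (\<lambda>y. ennreal (dens (y - \<mu>)))) A" .
    qed simp
  qed measurable
qed

end
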